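(* Let $\{m_n\}_{n=0}^\infty$ be a sequence of positive numbers satisfying the following two conditions: (SGR) for every $\alpha>0$ there is $c=c(\alpha)>0$ such that $c\,\alpha^n n!\le m_n$ for all $n\in\{0,1,2,\dots\}$; (BC) there are $h>1$ and $l>0$ such that $l h^n\le \sum_{k=0}^n \frac{m_n}{m_k m_{n-k}}$ for all $n\in\{0,1,2,\dots\}$. Then a scalar type spectral operator $A$ in a complex Banach space $(X,\|\cdot\|)$, with spectrum $\sigma(A)$, generates a $C_{(m_n)}$-semigroup (a Beurling type Carleman ultradifferentiable $C_0$-semigroup corresponding to $\{m_n\}_{n=0}^\infty$) if and only if, for any $b>0$, there is an $a\in\mathbb{R}$ such that $$\operatorname{Re}\lambda\le a-bM(|\operatorname{Im}\lambda|),\quad \lambda\in\sigma(A),$$ where $M(\lambda)=\ln T(\lambda)$, $0\le\lambda<\infty$, and the function $$T(\lambda):=m_0\sum_{n=0}^\infty \frac{\lambda^n}{m_n},\quad \lambda\ge 0\quad (0^0:=1),$$ is replaceable with any nonnegative, continuous, and increasing on $[0,\infty)$ function $F(\cdot)$ satisfying $$c_1F(\gamma_1\lambda)\le T(\lambda)\le c_2F(\gamma_2\lambda),\quad \lambda\ge R,$$ with some $\gamma_1,\gamma_2,c_1,c_2>0$ and $R\ge 0$.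
   Context: Scalar type spectral operator (in the sense of Dunford): a densely defined closed linear operator $A$ in a complex Banach space $X$ for which there is a spectral measure (resolution of the identity) $E_A(\cdot)$ on the Borel subsets of $\mathbb{C}$, that is, a strongly countably additive Boolean-homomorphic family of bounded projections on $X$ with $E_A(\mathbb{C})=I$ and $E_A(\delta\cap\sigma)=E_A(\delta)E_A(\sigma)$, supported on the spectrum $\sigma(A)$, such that $A=\int_{\sigma(A)}\lambda\,dE_A(\lambda)$. Here, for a Borel measurable $G:\sigma(A)\to\mathbb{C}$, the operator $G(A)=\int_{\sigma(A)}G(\lambda)\,dE_A(\lambda)$ is defined by $G(A)f:=\lim_{n\to\infty}G_n(A)f$ on the domain of all $f\in X$ for which this limit exists, where $G_n:=G\cdot\chi_{\{\lambda\in\sigma(A):|G(\lambda)|\le n\}}$ ($\chi_\delta$ is the characteristic function of $\delta$) and $G_n(A)=\int_{\sigma(A)}G_n\,dE_A$ is the bounded operator given by the integral of a bounded Borel function with respect to $E_A$. Beurling type Carleman class of vector functions: for an interval $I\subseteq\mathbb{R}$ and a sequence of positive numbers $\{m_n\}_{n=0}^\infty$, $C_{(m_n)}(I,X)$ is the set of all strongly infinitely differentiable functions $g:I\to X$ such that for every $[a,b]\subseteq I$ and every $\alpha>0$ there is $c>0$ with $\max_{a\le t\le b}\|g^{(n)}(t)\|\le c\,\alpha^n m_n$ for all $n=0,1,2,\dots$. $C_{(m_n)}$-semigroup: a $C_0$-semigroup (strongly continuous one-parameter semigroup of bounded linear operators) $\{S(t)\,|\,t\ge 0\}$ on $X$ such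 that for each $f\in X$ the orbit $S(\cdot)f$ belongs to $C_{(m_n)}((0,\infty),X)$. "$A$ generates a $C_{(m_n)}$-semigroup" means that $A$ is the infinitesimal generator of a $C_0$-semigroup that is a $C_{(m_n)}$-semigroup. Condition (SGR) ensures that the series defining $T$ converges for all $\lambda\ge0$; $T$ is continuous and strictly increasing with $T(0)=1$. Replacing $T$ with $F$ means using $\ln F$ in place of $M=\ln T$ in the spectral condition.
   Formalization: The replacement function F is required to be strictly positive on [0,∞) instead of merely nonnegative, since for F(0)=0 the logarithm ln F(0) is undefined and the replaced criterion fails. *)

theory Defs
  imports "HOL-Analysis.Analysis"
begin

section \<open>Complex Banach spaces and unbounded operators\<close>

text \<open>
  HOL-Analysis only has real Banach spaces. A complex Banach space is a real one whose scalar
  multiplication extends to the complex numbers, compatibly with the norm.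
\<close>

class complex_banach = banach +
  fixes scaleC :: "complex \<Rightarrow> 'a \<Rightarrow> 'a"  (infixr \<open>*\<^sub>C\<close> 75)
  assumes scaleC_add_right: "a *\<^sub>C (x + y) = a *\<^sub>C x + a *\<^sub>C y"
    and scaleC_add_left: "(a + b) *\<^sub>C x = a *\<^sub>C x + b *\<^sub>C x"
    and scaleC_scaleC: "a *\<^sub>C (b *\<^sub>C x) = (a * b) *\<^sub>C x"
    and scaleC_of_real: "complex_of_real r *\<^sub>C x = r *\<^sub>R x"
    and norm_scaleC: "norm (a *\<^sub>C x) = cmod a * norm x"

definition bounded_clinear :: "('a::complex_banach \<Rightarrow> 'a) \<Rightarrow> bool" where
  "bounded_clinear L \<longleftrightarrow> bounded_linear L \<and> (\<forall>c x. L (c *\<^sub>C x) = c *\<^sub>C L x)"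

text \<open>
  An unbounded operator is a partial map, so that equality of operators includes equality of their
  domains.
\<close>

definition linear_operator :: "('a::complex_banach \<rightharpoonup> 'a) \<Rightarrow> bool" where
  "linear_operator A \<longleftrightarrow>
     A 0 = Some 0 \<and>
     (\<forall>x\<in>dom A. \<forall>y\<in>dom A. A (x + y) = Some (the (A x) + the (A y))) \<and>
     (\<forall>c. \<forall>x\<in>dom A. A (c *\<^sub>C x) = Some (c *\<^sub>C the (A x)))"

definition densely_defined :: "('a::complex_banach \<rightharpoonup> 'a) \<Rightarrow> bool" where
  "densely_defined A \<longleftrightarrow> closure (dom A) = UNIV"

definition closed_operator :: "('a::complex_banach \<rightharpoonup> 'a) \<Rightarrow> bool" where
  "closed_operator A \<longleftrightarrow> closed (Map.graph A)"

definition resolvent_set :: "('a::complex_banach \<rightharpoonup> 'a) \<Rightarrow> complex set" where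
  "resolvent_set A = {z. \<exists>R. bounded_clinear R \<and>
     (\<forall>y. R y \<in> dom A \<and> z *\<^sub>C R y - the (A (R y)) = y) \<and>
     (\<forall>x\<in>dom A. R (z *\<^sub>C x - the (A x)) = x)}"

definition spectrum :: "('a::complex_banach \<rightharpoonup> 'a) \<Rightarrow> complex set" where
  "spectrum A = - resolvent_set A"


section \<open>Spectral measures and scalar type spectral operators\<close>

text \<open>
  The values of \<open>E\<close> on non-Borel sets are irrelevant. The clauses imply \<open>E {} = 0\<close> and
  \<open>E (- \<delta>) = I - E \<delta>\<close>, i.e. that \<open>E\<close> is a Boolean homomorphism; the product
  clause makes each \<open>E \<delta>\<close> a projection.
\<close>

definition spectral_measure :: "(complex set \<Rightarrow> 'a::complex_banach \<Rightarrow> 'a) \<Rightarrow> bool" where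
  "spectral_measure E \<longleftrightarrow>
     (\<forall>\<delta>\<in>sets borel. bounded_clinear (E \<delta>)) \<and>
     E UNIV = id \<and>
     (\<forall>\<delta>\<in>sets borel. \<forall>\<sigma>\<in>sets borel. E (\<delta> \<inter> \<sigma>) = E \<delta> \<circ> E \<sigma>) \<and>
     (\<forall>D :: nat \<Rightarrow> complex set. range D \<subseteq> sets borel \<longrightarrow> disjoint_family D \<longrightarrow>
        (\<forall>f. (\<lambda>n. E (D n) f) sums E (\<Union>n. D n) f))"

definition simple_spectral_integral ::
    "(complex set \<Rightarrow> 'a::complex_banach \<Rightarrow> 'a) \<Rightarrow> (complex \<Rightarrow> complex) \<Rightarrow> 'a \<Rightarrow> 'a" where
  "simple_spectral_integral E s f = (\<Sum>c\<in>range s. c *\<^sub>C E (s -` {c}) f)"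

text \<open>
  For a bounded Borel function \<open>G\<close>: the common limit of the integrals of simple Borel
  functions converging uniformly to \<open>G\<close>.
\<close>

definition bounded_spectral_integral ::
    "(complex set \<Rightarrow> 'a::complex_banach \<Rightarrow> 'a) \<Rightarrow> (complex \<Rightarrow> complex) \<Rightarrow> 'a \<Rightarrow> 'a" where
  "bounded_spectral_integral E G f =
     (THE y. \<exists>s. (\<forall>n. simple_function borel (s n)) \<and> uniform_limit UNIV s G sequentially \<and>
        (\<lambda>n. simple_spectral_integral E (s n) f) \<longlonglongrightarrow> y)"

definition truncation ::
    "complex set \<Rightarrow> (complex \<Rightarrow> complex) \<Rightarrow> nat \<Rightarrow> complex \<Rightarrow> complex" where
  "truncation \<Omega> G n z = indicator {z\<in>\<Omega>. cmod (G z) \<le> real n} z * G z"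

text \<open>The possibly unbounded operator given by the integral over \<open>\<Omega>\<close>.\<close>

definition spectral_integral ::
    "(complex set \<Rightarrow> 'a::complex_banach \<Rightarrow> 'a) \<Rightarrow> complex set \<Rightarrow> (complex \<Rightarrow> complex) \<Rightarrow> ('a \<rightharpoonup> 'a)" where
  "spectral_integral E \<Omega> G = (\<lambda>f.
     let u = (\<lambda>n. bounded_spectral_integral E (truncation \<Omega> G n) f)
     in if convergent u then Some (lim u) else None)"

definition scalar_type_spectral :: "('a::complex_banach \<rightharpoonup> 'a) \<Rightarrow> bool" where
  "scalar_type_spectral A \<longleftrightarrow>
     linear_operator A \<and> densely_defined A \<and> closed_operator A \<and>
     (\<exists>E. spectral_measure E \<and> E (spectrum A) = id \<and>
          A = spectral_integral E (spectrum A) (\<lambda>z. z))"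


section \<open>Semigroups and Carleman classes\<close>

text \<open>The values of \<open>S\<close> at negative times are irrelevant.\<close>

definition C0_semigroup :: "(real \<Rightarrow> 'a::complex_banach \<Rightarrow> 'a) \<Rightarrow> bool" where
  "C0_semigroup S \<longleftrightarrow>
     (\<forall>t\<ge>0. bounded_clinear (S t)) \<and> S 0 = id \<and>
     (\<forall>t\<ge>0. \<forall>s\<ge>0. S (t + s) = S t \<circ> S s) \<and>
     (\<forall>f. continuous_on {0..} (\<lambda>t. S t f))"

definition generator :: "(real \<Rightarrow> 'a::complex_banach \<Rightarrow> 'a) \<Rightarrow> ('a \<rightharpoonup> 'a)" where
  "generator S = (\<lambda>f.
     let q = (\<lambda>t. (S t f - f) /\<^sub>R t)
     in if \<exists>y. (q \<longlongrightarrow> y) (at_right 0) then Some (Lim (at_right 0) q) else None)"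

primrec nth_vector_derivative ::
    "real set \<Rightarrow> (real \<Rightarrow> 'a::real_normed_vector) \<Rightarrow> nat \<Rightarrow> real \<Rightarrow> 'a" where
  "nth_vector_derivative I g 0 = g"
| "nth_vector_derivative I g (Suc n) =
     (\<lambda>t. vector_derivative (nth_vector_derivative I g n) (at t within I))"

text \<open>
  The Beurling type Carleman class on a (nondegenerate) interval \<open>I\<close>. A bound on the maximum
  over \<open>[a, b]\<close> is expressed pointwise.
\<close>

definition carleman_beurling ::
    "(nat \<Rightarrow> real) \<Rightarrow> real set \<Rightarrow> (real \<Rightarrow> 'a::real_normed_vector) set" where
  "carleman_beurling m I = {g.
     (\<forall>n. nth_vector_derivative I g n differentiable_on I) \<and>
     (\<forall>a b. a \<le> b \<longrightarrow> {a..b} \<subseteq> I \<longrightarrow>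
        (\<forall>\<alpha>>0. \<exists>c>0. \<forall>n. \<forall>t\<in>{a..b}. norm (nth_vector_derivative I g n t) \<le> c * \<alpha> ^ n * m n))}"

definition carleman_semigroup ::
    "(nat \<Rightarrow> real) \<Rightarrow> (real \<Rightarrow> 'a::complex_banach \<Rightarrow> 'a) \<Rightarrow> bool" where
  "carleman_semigroup m S \<longleftrightarrow>
     C0_semigroup S \<and> (\<forall>f. (\<lambda>t. S t f) \<in> carleman_beurling m {0<..})"

definition generates_carleman_semigroup ::
    "(nat \<Rightarrow> real) \<Rightarrow> ('a::complex_banach \<rightharpoonup> 'a) \<Rightarrow> bool" where
  "generates_carleman_semigroup m A \<longleftrightarrow> (\<exists>S. carleman_semigroup m S \<and> A = generator S)"


section \<open>Conditions on the sequence and the associated function\<close>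

definition SGR :: "(nat \<Rightarrow> real) \<Rightarrow> bool" where
  "SGR m \<longleftrightarrow> (\<forall>\<alpha>>0. \<exists>c>0. \<forall>n. c * \<alpha> ^ n * fact n \<le> m n)"

definition BC :: "(nat \<Rightarrow> real) \<Rightarrow> bool" where
  "BC m \<longleftrightarrow> (\<exists>h>1. \<exists>l>0. \<forall>n. l * h ^ n \<le> (\<Sum>k\<le>n. m n / (m k * m (n - k))))"

definition carleman_T :: "(nat \<Rightarrow> real) \<Rightarrow> real \<Rightarrow> real" where
  "carleman_T m x = m 0 * (\<Sum>n. x ^ n / m n)"

definition carleman_M :: "(nat \<Rightarrow> real) \<Rightarrow> real \<Rightarrow> real" where
  "carleman_M m x = ln (carleman_T m x)"

text \<open>
  The functions \<open>F\<close> that may replace \<open>T\<close>. Positivity is required on all of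
  \<open>[0, \<infinity>)\<close>, and not only \<open>F \<ge> 0\<close>, because \<open>ln F\<close> has to be a
  real-valued function there: if \<open>F 0 = 0\<close>, then \<open>- ln F\<close> is unbounded near \<open>0\<close>
  and \<open>Re z \<le> a - b * ln (F \<bar>Im z\<bar>)\<close> no longer bounds the real part of the spectrum near the
  real axis. ``Increasing'' is taken in the weak sense.
\<close>

definition T_replacement :: "(nat \<Rightarrow> real) \<Rightarrow> (real \<Rightarrow> real) \<Rightarrow> bool" where
  "T_replacement m F \<longleftrightarrow>
     (\<forall>x\<ge>0. 0 < F x) \<and> continuous_on {0..} F \<and> mono_on {0..} F \<and>
     (\<exists>\<gamma>\<^sub>1>0. \<exists>\<gamma>\<^sub>2>0. \<exists>c\<^sub>1>0. \<exists>c\<^sub>2>0. \<exists>R\<ge>0. \<forall>x\<ge>R.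
        c\<^sub>1 * F (\<gamma>\<^sub>1 * x) \<le> carleman_T m x \<and> carleman_T m x \<le> c\<^sub>2 * F (\<gamma>\<^sub>2 * x))"

end

theory Submission
  imports Defs
begin

text \<open>
  Write \<open>E\<close> for the spectral measure of \<open>A\<close> and \<open>\<sigma>\<close> for its spectrum. On the spectral
  side everything is governed by one family of numbers: the class condition on all orbits of the
  semigroup is equivalent to the estimates \<open>\<bar>z\<bar>\<^sup>n e\<^bsup>t Re z\<^esup> \<le> c \<alpha>\<^sup>n m\<^sub>n\<close> on \<open>\<sigma>\<close>, for every \<open>\<alpha> > 0\<close>, with \<open>c\<close>
  uniform in \<open>z\<close>, in \<open>n\<close> and in \<open>t\<close> from compact subintervals of the open half-line. Summing or
  unsumming over \<open>n\<close> turns these estimates into the bound of \<open>Re z\<close> by \<open>M \<bar>Im z\<bar>\<close>.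

  \<^bold>\<open>The calculus.\<close> A strongly countably additive spectral measure is uniformly bounded: its range on
  each vector is bounded by a gliding-hump argument (\<open>bounded_orbit_of_E\<close>), and the uniform
  boundedness principle does the rest. Hence integrals of simple functions are bounded by the
  supremum norm, the integral of bounded Borel functions is a bounded algebra homomorphism, and it
  satisfies a dominated convergence theorem (\<open>dominated_convergence\<close>). The spectrum is closed, so it
  is a Borel set, and \<open>A f = y\<close> just says that \<open>E(\<delta>\<^sub>n) y\<close> is the integral of \<open>z\<close> over \<open>\<delta>\<^sub>n\<close> applied to
  \<open>f\<close>, where \<open>\<delta>\<^sub>n\<close> is the part of \<open>\<sigma>\<close> in the disc of radius \<open>n\<close> (\<open>A_Some_iff\<close>). On the range of
  \<open>E(\<delta>\<^sub>n)\<close> all operators in question are bounded, and a vector is determined by its projections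
  to these ranges.

  \<^bold>\<open>Sufficiency.\<close> If \<open>Re z\<close> is bounded above on \<open>\<sigma>\<close>, the integrals of \<open>e\<^bsup>tz\<^esup>\<close> form a
  \<open>C\<^sub>0\<close>-semigroup with generator \<open>A\<close>. Given the estimates of \<open>\<bar>z\<bar>\<^sup>n e\<^bsup>t Re z\<^esup>\<close>, dominated convergence
  allows differentiation under the integral, so the \<open>n\<close>-th derivative of an orbit is the integral of
  \<open>z\<^sup>n e\<^bsup>tz\<^esup>\<close> and obeys the same estimates. To obtain them, powers of the real part are absorbed by
  the exponential at the cost of \<open>n!\<close> and a geometric factor, which (SGR) bounds by a multiple of
  \<open>m\<^sub>n\<close>. For powers of the imaginary part, \<open>m\<^sub>0 x\<^sup>n / m\<^sub>n \<le> T x\<close> for every term of the series; here the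
  arbitrary factor \<open>\<alpha>\<close> requires comparing \<open>T (r x)\<close> with a power of \<open>T x\<close>. Condition (BC) provides
  this: the coefficients of the Cauchy square of \<open>T\<close> are the sums in (BC) times \<open>m\<^sub>0\<^sup>2 / m\<^sub>n\<close>, which
  gives \<open>T (h x) \<le> c (T x)\<^sup>2\<close>, and \<open>h > 1\<close> can be iterated (\<open>M_dilate\<close>).

  \<^bold>\<open>Necessity.\<close> Every orbit \<open>u\<close> of a semigroup of the class is differentiable with \<open>u' = A u\<close>. Under
  \<open>E(\<delta>\<^sub>n)\<close> this becomes a linear equation with a bounded operator, so \<open>E(\<delta>\<^sub>n) u\<close> is the integral of
  \<open>e\<^bsup>tz\<^esup>\<close> over \<open>\<delta>\<^sub>n\<close> applied to \<open>u(0)\<close> (\<open>E_core_orbit\<close>); likewise for the derivatives. The class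
  condition bounds these vectors for each orbit, and the uniform boundedness principle makes the
  constant independent of the orbit. Every point of the spectrum is in the support of \<open>E\<close>
  (\<open>null_ball_resolvent\<close>), so operator norms bound the values of the functions on \<open>\<sigma>\<close>
  (\<open>spectral_value_le\<close>). Taking \<open>t = 1 / b\<close> and \<open>\<alpha> = 1 / 2\<close> and summing over \<open>n\<close> gives the bound with
  the constant \<open>b\<close>.

  \<^bold>\<open>Replacing T.\<close> By the same dilation property, \<open>ln F\<close> and \<open>M\<close> are each bounded by an affine
  function of the other, and such a change is absorbed by the quantification over all \<open>b > 0\<close>.
\<close>

section \<open>Complex scalars\<close>

interpretation scaleC: bounded_bilinear "(*\<^sub>C) :: complex \<Rightarrow> 'a::complex_banach \<Rightarrow> 'a"
proof
  fix a b :: complex and x y :: 'a and r :: real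
  show "(a + b) *\<^sub>C x = a *\<^sub>C x + b *\<^sub>C x" "a *\<^sub>C (x + y) = a *\<^sub>C x + a *\<^sub>C y"
    by (fact scaleC_add_left scaleC_add_right)+
  show "(r *\<^sub>R a) *\<^sub>C x = r *\<^sub>R a *\<^sub>C x"
    by (simp add: scaleR_conv_of_real scaleC_scaleC flip: scaleC_of_real)
  show "a *\<^sub>C r *\<^sub>R x = r *\<^sub>R a *\<^sub>C x"
    by (simp add: scaleC_scaleC mult.commute flip: scaleC_of_real)
  show "\<exists>K. \<forall>a (x::'a). norm (a *\<^sub>C x) \<le> norm a * norm x * K"
    by (rule exI[of _ 1]) (simp add: norm_scaleC)
qed

lemma scaleC_one [simp]: "1 *\<^sub>C x = (x :: 'a::complex_banach)"
  using scaleC_of_real[of 1 x] by simp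

lemma bounded_clinear_add: "bounded_clinear f \<Longrightarrow> f (x + y) = f x + f y"
  and bounded_clinear_diff: "bounded_clinear f \<Longrightarrow> f (x - y) = f x - f y"
  and bounded_clinear_scaleC: "bounded_clinear f \<Longrightarrow> f (c *\<^sub>C x) = c *\<^sub>C f x"
  and bounded_clinear_zero: "bounded_clinear f \<Longrightarrow> f 0 = 0"
  and bounded_clinear_bounded_linear: "bounded_clinear f \<Longrightarrow> bounded_linear f"
  by (auto simp: bounded_clinear_def linear_simps)

lemma bounded_clinearI:
  fixes f :: "'a::complex_banach \<Rightarrow> 'a"
  assumes add: "\<And>x y. f (x + y) = f x + f y" and scale: "\<And>c x. f (c *\<^sub>C x) = c *\<^sub>C f x"
    and bound: "\<And>x. norm (f x) \<le> C * norm x"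
  shows "bounded_clinear f"
  unfolding bounded_clinear_def
proof (intro conjI allI scale bounded_linear_intro[where K = C])
  show "f (r *\<^sub>R x) = r *\<^sub>R f x" for r x
    using scale[of "complex_of_real r" x] by (simp add: scaleC_of_real)
  show "norm (f x) \<le> norm x * C" for x
    using bound[of x] by (simp add: mult.commute)
qed (rule add)

section \<open>The uniform boundedness principle\<close>

text \<open>
  By Baire's theorem one of the closed sets of vectors on which the family is bounded by a
  fixed number contains a ball; differences of vectors of the ball fill a ball around the origin.
\<close>

theorem uniform_boundedness:
  fixes F :: "'i \<Rightarrow> 'a::banach \<Rightarrow> 'b::real_normed_vector"
  assumes lin: "\<And>i. i \<in> I \<Longrightarrow> bounded_linear (F i)"
    and ptw: "\<And>x. \<exists>c. \<forall>i\<in>I. norm (F i x) \<le> c"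
  shows "\<exists>C\<ge>0. \<forall>i\<in>I. \<forall>x. norm (F i x) \<le> C * norm x"
proof -
  define V where "V n = {x. \<forall>i\<in>I. norm (F i x) \<le> real n}" for n
  have "closed (V n)" for n
  proof -
    have "closed {x. norm (F i x) \<le> real n}" if "i \<in> I" for i
      using lin[OF that] by (intro closed_Collect_le continuous_intros linear_continuous_on)
    moreover have "V n = (\<Inter>i\<in>I. {x. norm (F i x) \<le> real n})"
      by (auto simp: V_def)
    ultimately show ?thesis by auto
  qed
  moreover have "(\<Union>n. V n) = UNIV"
  proof (rule UNIV_eq_I[THEN sym])
    fix x
    obtain c where "\<forall>i\<in>I. norm (F i x) \<le> c"
      using ptw by blast
    moreover obtain n where "c \<le> real n"
      using real_arch_simple by blast
    ultimately have "x \<in> V n"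
      by (force simp: V_def)
    then show "x \<in> (\<Union>n. V n)"
      by blast
  qed
  moreover have "completely_metrizable_space (euclidean :: 'a topology)"
    by (rule completely_metrizable_space_euclidean)
  ultimately have "\<exists>n. interior (V n) \<noteq> {}"
    using Baire_category_alt[of "euclidean :: 'a topology" "range V"] by auto
  then obtain n x e where e: "e > 0" "cball x e \<subseteq> V n"
    by (meson all_not_in_conv mem_interior_cball)
  have "norm (F i y) \<le> (2 * real n / e) * norm y" if i: "i \<in> I" for i y
  proof (cases "y = 0")
    case True
    then show ?thesis using lin[OF i] by (simp add: linear_simps)
  next
    case False
    interpret bounded_linear "F i" by (rule lin[OF i])
    define z where "z = (e / norm y) *\<^sub>R y"
    have "x + z \<in> V n" "x \<in> V n"
      using e False by (auto simp: z_def dist_norm)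
    then have "norm (F i (x + z)) \<le> n" "norm (F i x) \<le> n"
      using i by (auto simp: V_def)
    then have "norm (F i z) \<le> 2 * real n"
      using norm_triangle_ineq4[of "F i (x + z)" "F i x"] by (simp add: add)
    moreover have "norm (F i z) = e / norm y * norm (F i y)"
      using e by (simp add: z_def scaleR)
    ultimately show ?thesis
      using e False by (simp add: field_simps)
  qed
  then show ?thesis
    using e by (intro exI[of _ "2 * real n / e"]) auto
qed

section \<open>The spectrum is closed\<close>

text \<open>
  For \<open>w\<close> close to \<open>z\<close>, the resolvent at \<open>w\<close> is \<open>R (I - d R)\<^sup>-\<^sup>1\<close> with \<open>d = z - w\<close>. The inverse is not
  written as a Neumann series: its value \<open>Q y\<close> is the fixed point of the contraction
  \<open>x \<mapsto> y + d R x\<close>. The openness is what makes the spectrum a Borel set, without which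
  \<open>E (spectrum A) = id\<close> would carry no information.
\<close>

lemma open_resolvent_set:
  fixes A :: "'a::complex_banach \<rightharpoonup> 'a"
  shows "open (resolvent_set A)"
  unfolding open_dist
proof (intro ballI)
  fix z assume "z \<in> resolvent_set A"
  then obtain R where R: "bounded_clinear R" and dom: "\<And>y. R y \<in> dom A"
    and right: "\<And>y. z *\<^sub>C R y - the (A (R y)) = y"
    and left: "\<And>x. x \<in> dom A \<Longrightarrow> R (z *\<^sub>C x - the (A x)) = x"
    by (auto simp: resolvent_set_def)
  obtain C where C: "C > 0" "\<And>x. norm (R x) \<le> norm x * C"
    using bounded_linear.pos_bounded[OF bounded_clinear_bounded_linear[OF R]] by blast
  have "w \<in> resolvent_set A" if w: "dist w z < 1 / (2 * C)" for w
  proof -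
    define d where "d = z - w"
    have d: "norm (d *\<^sub>C R x) \<le> norm x / 2" for x
    proof -
      have "norm (d *\<^sub>C R x) \<le> (1 / (2 * C)) * (norm x * C)"
        unfolding norm_scaleC using w C
        by (intro mult_mono) (auto simp: d_def dist_norm norm_minus_commute)
      then show ?thesis using C by simp
    qed
    have "\<exists>!x. y + d *\<^sub>C R x = x" for y
    proof (rule banach_fix_type[of "1/2"])
      show "\<forall>x x'. dist (y + d *\<^sub>C R x) (y + d *\<^sub>C R x') \<le> 1 / 2 * dist x x'"
      proof (intro allI)
        fix x x'
        show "dist (y + d *\<^sub>C R x) (y + d *\<^sub>C R x') \<le> 1 / 2 * dist x x'"
          using d[of "x - x'"]
          by (simp add: dist_norm bounded_clinear_diff[OF R] scaleC.diff_right)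
      qed
    qed auto
    then obtain Q where Q: "\<And>y. y + d *\<^sub>C R (Q y) = Q y"
      and Q_unique: "\<And>x y. y + d *\<^sub>C R x = x \<Longrightarrow> Q y = x"
      by metis
    have "bounded_clinear Q"
    proof (rule bounded_clinearI)
      show "Q (x + y) = Q x + Q y" for x y
      proof (rule Q_unique)
        have "x + y + d *\<^sub>C R (Q x + Q y) = (x + d *\<^sub>C R (Q x)) + (y + d *\<^sub>C R (Q y))"
          by (simp add: bounded_clinear_add[OF R] scaleC_add_right)
        then show "x + y + d *\<^sub>C R (Q x + Q y) = Q x + Q y"
          by (simp only: Q)
      qed
      show "Q (c *\<^sub>C x) = c *\<^sub>C Q x" for c x
      proof (rule Q_unique)
        have "c *\<^sub>C x + d *\<^sub>C R (c *\<^sub>C Q x) = c *\<^sub>C (x + d *\<^sub>C R (Q x))"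
          by (simp add: bounded_clinear_scaleC[OF R] scaleC_add_right scaleC_scaleC mult.commute)
        then show "c *\<^sub>C x + d *\<^sub>C R (c *\<^sub>C Q x) = c *\<^sub>C Q x"
          by (simp only: Q)
      qed
      show "norm (Q y) \<le> 2 * norm y" for y
        using norm_triangle_ineq[of y "d *\<^sub>C R (Q y)"] d[of "Q y"] Q[of y] by simp
    qed
    then have "bounded_clinear (R \<circ> Q)"
      using R by (auto simp: bounded_clinear_def bounded_linear_compose o_def)
    moreover have "w *\<^sub>C R (Q y) - the (A (R (Q y))) = y" for y
    proof -
      have "w *\<^sub>C R (Q y) - the (A (R (Q y))) = Q y - d *\<^sub>C R (Q y)"
        using right[of "Q y"] by (simp add: d_def scaleC.diff_left algebra_simps)
      also have "\<dots> = y"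
        by (metis Q add_diff_cancel)
      finally show ?thesis .
    qed
    moreover have "R (Q (w *\<^sub>C x - the (A x))) = x" if x: "x \<in> dom A" for x
    proof -
      have "Q (w *\<^sub>C x - the (A x)) = z *\<^sub>C x - the (A x)"
        using left[OF x] by (intro Q_unique) (simp add: d_def scaleC.diff_left)
      then show ?thesis using left[OF x] by simp
    qed
    ultimately show ?thesis
      using dom unfolding resolvent_set_def mem_Collect_eq
      by (intro exI[of _ "R \<circ> Q"] conjI ballI allI) (simp_all only: o_apply)
  qed
  then show "\<exists>e>0. \<forall>w. dist w z < e \<longrightarrow> w \<in> resolvent_set A"
    using C by (intro exI[of _ "1 / (2 * C)"]) auto
qed

lemma closed_spectrum: "closed (spectrum A)"
  unfolding spectrum_def closed_def by (simp add: open_resolvent_set)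

section \<open>Sums with bounded complex coefficients\<close>

text \<open>
  A convex function on a cube attains its maximum at a vertex; each induction step moves one
  coefficient to \<open>0\<close> or \<open>1\<close>. With this, bounds for sums of values of a vector measure give
  bounds for integrals without passing to scalar measures.
\<close>

lemma norm_sum_le_vertex:
  fixes x :: "'i \<Rightarrow> 'b::real_normed_vector"
  assumes "finite I" "\<And>i. i \<in> I \<Longrightarrow> 0 \<le> c i \<and> c i \<le> (1::real)"
  shows "\<exists>J\<subseteq>I. norm (v + (\<Sum>i\<in>I. c i *\<^sub>R x i)) \<le> norm (v + (\<Sum>i\<in>J. x i))"
  using assms
proof (induction I arbitrary: v rule: finite_induct)
  case empty
  then show ?case by simp
next
  case (insert a I)
  define S where "S = (\<Sum>i\<in>I. c i *\<^sub>R x i)"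
  have c: "0 \<le> c a" "c a \<le> 1"
    using insert.prems by auto
  have "v + (\<Sum>i\<in>insert a I. c i *\<^sub>R x i) = (1 - c a) *\<^sub>R (v + S) + c a *\<^sub>R (v + x a + S)"
    using insert.hyps by (simp add: S_def algebra_simps)
  also have "norm \<dots> \<le> (1 - c a) * norm (v + S) + c a * norm (v + x a + S)"
    using c by (intro norm_triangle_le) simp
  also have "\<dots> \<le> max (norm (v + S)) (norm (v + x a + S))"
    using c by (intro convex_bound_le) auto
  finally have le: "norm (v + (\<Sum>i\<in>insert a I. c i *\<^sub>R x i)) \<le> max (norm (v + S)) (norm (v + x a + S))" .
  obtain J where J: "J \<subseteq> I" "norm (v + S) \<le> norm (v + sum x J)"
    using insert.IH[of v] insert.prems unfolding S_def by auto
  obtain J' where J': "J' \<subseteq> I" "norm (v + x a + S) \<le> norm (v + x a + sum x J')"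
    using insert.IH[of "v + x a"] insert.prems unfolding S_def by auto
  have "sum x (insert a J') = x a + sum x J'"
    using J'(1) insert.hyps by (meson finite_subset subsetD sum.insert)
  then have "norm (v + x a + S) \<le> norm (v + sum x (insert a J'))"
    using J'(2) by (simp add: add.assoc)
  then have J'': "insert a J' \<subseteq> insert a I" "norm (v + x a + S) \<le> norm (v + sum x (insert a J'))"
    using J'(1) by auto
  show ?case
  proof (cases "norm (v + S) \<le> norm (v + x a + S)")
    case True
    then show ?thesis
      using J'' le by (intro exI[of _ "insert a J'"]) auto
  next
    case False
    then show ?thesis
      using J le by (intro exI[of _ J]) auto
  qed
qed

lemma norm_sum_scaleR_le:
  fixes x :: "'i \<Rightarrow> 'b::real_normed_vector"
  assumes "finite I" and r: "\<And>i. i \<in> I \<Longrightarrow> \<bar>r i\<bar> \<le> B" and "0 \<le> B"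
    and M: "\<And>J. J \<subseteq> I \<Longrightarrow> norm (\<Sum>i\<in>J. x i) \<le> M"
  shows "norm (\<Sum>i\<in>I. r i *\<^sub>R x i) \<le> 2 * B * M"
proof -
  have pos: "norm (\<Sum>i\<in>I. c i *\<^sub>R x i) \<le> B * M" 
    if c: "\<And>i. i \<in> I \<Longrightarrow> 0 \<le> c i \<and> c i \<le> B" for c
  proof (cases "B = 0")
    case True
    then have "c i = 0" if "i \<in> I" for i
      using c[OF that] by simp
    then show ?thesis using True by simp
  next
    case False
    have "\<exists>J\<subseteq>I. norm (0 + (\<Sum>i\<in>I. (c i / B) *\<^sub>R x i)) \<le> norm (0 + (\<Sum>i\<in>J. x i))"
      using c False \<open>0 \<le> B\<close> by (intro norm_sum_le_vertex \<open>finite I\<close>) (auto simp: divide_simps)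
    then have "norm (\<Sum>i\<in>I. (c i / B) *\<^sub>R x i) \<le> M"
      using M by (force intro: order_trans)
    moreover have "(\<Sum>i\<in>I. c i *\<^sub>R x i) = B *\<^sub>R (\<Sum>i\<in>I. (c i / B) *\<^sub>R x i)"
      using False by (simp add: scaleR_sum_right)
    ultimately show ?thesis
      using \<open>0 \<le> B\<close> by (simp add: mult_left_mono)
  qed
  have "(\<Sum>i\<in>I. r i *\<^sub>R x i) = (\<Sum>i\<in>I. max (r i) 0 *\<^sub>R x i) - (\<Sum>i\<in>I. max (- r i) 0 *\<^sub>R x i)"
    unfolding sum_subtractf[symmetric] scaleR_diff_left[symmetric]
    by (intro sum.cong arg_cong2[of _ _ _ _ scaleR]) auto
  also have "norm \<dots> \<le> B * M + B * M"
    using r \<open>0 \<le> B\<close> by (intro order_trans[OF norm_triangle_ineq4] add_mono pos) force+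
  finally show ?thesis by simp
qed

text \<open>
  Each of the positive and negative parts of the real and imaginary coefficients contributes one
  cube, whence the factor \<open>4\<close>.
\<close>

lemma norm_sum_scaleC_le:
  fixes x :: "'i \<Rightarrow> 'b::complex_banach"
  assumes "finite I" and c: "\<And>i. i \<in> I \<Longrightarrow> cmod (c i) \<le> B" and "0 \<le> B"
    and M: "\<And>J. J \<subseteq> I \<Longrightarrow> norm (\<Sum>i\<in>J. x i) \<le> M"
  shows "norm (\<Sum>i\<in>I. c i *\<^sub>C x i) \<le> 4 * B * M"
proof -
  have "c i *\<^sub>C x i = Re (c i) *\<^sub>R x i + \<i> *\<^sub>C Im (c i) *\<^sub>R x i" for i
    by (subst complex_eq) (simp only: scaleC_add_left scaleC_of_real flip: scaleC_scaleC)
  then have "(\<Sum>i\<in>I. c i *\<^sub>C x i) = (\<Sum>i\<in>I. Re (c i) *\<^sub>R x i) + \<i> *\<^sub>C (\<Sum>i\<in>I. Im (c i) *\<^sub>R x i)"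
    by (simp add: sum.distrib scaleC.sum_right)
  also have "norm \<dots> \<le> norm (\<Sum>i\<in>I. Re (c i) *\<^sub>R x i) + norm (\<Sum>i\<in>I. Im (c i) *\<^sub>R x i)"
    by (rule order_trans[OF norm_triangle_ineq]) (simp add: norm_scaleC)
  also have "\<dots> \<le> 2 * B * M + 2 * B * M"
    using c abs_Re_le_cmod abs_Im_le_cmod
    by (intro add_mono norm_sum_scaleR_le assms) (meson order_trans)+
  finally show ?thesis by simp
qed

section \<open>Uniform approximation by simple functions\<close>

text \<open>
  Rounding the real and imaginary parts down to multiples of \<open>1 / (n + 1)\<close>; boundedness makes the
  range finite.
\<close>

lemma uniform_simple_approximation:
  assumes G[measurable]: "G \<in> borel_measurable borel" and B: "\<And>z. cmod (G z) \<le> B"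
  shows "\<exists>s. \<forall>n. simple_function borel (s n) \<and> (\<forall>z::complex. cmod (s n z - G z) \<le> 2 / Suc n)"
proof -
  define r where "r n x = real_of_int \<lfloor>Suc n * x\<rfloor> / Suc n" for n :: nat and x :: real
  define s where "s n z = complex_of_real (r n (Re (G z))) + \<i> * complex_of_real (r n (Im (G z)))" for n z
  have r_close: "\<bar>r n x - x\<bar> \<le> 1 / Suc n" for n x
  proof -
    have "r n x - x = (real_of_int \<lfloor>Suc n * x\<rfloor> - Suc n * x) / Suc n"
      by (simp add: r_def diff_divide_distrib del: of_nat_Suc)
    then show ?thesis
      by (simp only: abs_divide abs_of_nat) (intro divide_right_mono, linarith+)
  qed
  have close: "cmod (s n z - G z) \<le> 2 / Suc n" for n z
  proof -
    have "s n z - G z = complex_of_real (r n (Re (G z)) - Re (G z)) + \<i> * complex_of_real (r n (Im (G z)) - Im (G z))"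
      by (simp add: s_def complex_eq_iff)
    also have "cmod \<dots> \<le> 1 / Suc n + 1 / Suc n"
      using r_close by (intro norm_triangle_mono) (simp_all add: norm_mult del: of_real_diff of_nat_Suc)
    finally show ?thesis by simp
  qed
  have simple: "simple_function borel (s n)" for n
  proof (rule simple_function_borel_measurable)
    show "s n \<in> borel_measurable borel"
      unfolding s_def[abs_def] r_def by measurable
    define M where "M = \<lceil>Suc n * B\<rceil> + 1"
    have M: "\<lfloor>Suc n * x\<rfloor> \<in> {-M..M}" if "\<bar>x\<bar> \<le> B" for x :: real
    proof -
      have "\<bar>Suc n * x\<bar> \<le> Suc n * B"
        unfolding abs_mult abs_of_nat using that by (intro mult_left_mono) auto
      then show ?thesis unfolding M_def by simp linarith
    qed
    have "\<bar>Re (G z)\<bar> \<le> B" "\<bar>Im (G z)\<bar> \<le> B" for z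
      using B abs_Re_le_cmod abs_Im_le_cmod order_trans by blast+
    then have "s n z \<in> (\<lambda>(i, j). complex_of_real (real_of_int i / Suc n) + \<i> * complex_of_real (real_of_int j / Suc n)) ` ({-M..M} \<times> {-M..M})" for z
      using M unfolding s_def r_def by (intro image_eqI[where x = "(_, _)"]) auto
    then have "range (s n) \<subseteq> (\<lambda>(i, j). complex_of_real (real_of_int i / Suc n) + \<i> * complex_of_real (real_of_int j / Suc n)) ` ({-M..M} \<times> {-M..M})"
      by blast
    from finite_subset[OF this] show "finite (s n ` space borel)"
      by simp
  qed
  show ?thesis using close simple by blast
qed

lemma uniform_limit_rate:
  assumes "\<And>n z. cmod (s n z - G z) \<le> 2 / Suc n"
  shows "uniform_limit UNIV s G sequentially"
proof (rule uniform_limitI)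
  fix e :: real assume "e > 0"
  have "(\<lambda>n. 2 * inverse (real (Suc n))) \<longlonglongrightarrow> 2 * 0"
    by (intro tendsto_intros LIMSEQ_inverse_real_of_nat)
  then have "eventually (\<lambda>n. 2 * inverse (real (Suc n)) < e) sequentially"
    using \<open>e > 0\<close> by (intro order_tendstoD(2)) auto
  then have "eventually (\<lambda>n. 2 / Suc n < e) sequentially"
    by (simp only: divide_inverse)
  then show "\<forall>\<^sub>F n in sequentially. \<forall>z\<in>UNIV. dist (s n z) (G z) < e"
    by (rule eventually_mono) (use assms in \<open>auto simp: dist_norm intro: le_less_trans\<close>)
qed

section \<open>Boundedness of a spectral measure\<close>

locale resolution_of_identity =
  fixes E :: "complex set \<Rightarrow> 'a::complex_banach \<Rightarrow> 'a"
  assumes spectral_measure: "spectral_measure E"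
begin

lemma bounded_clinear_E: "D \<in> sets borel \<Longrightarrow> bounded_clinear (E D)"
  and E_UNIV: "E UNIV f = f"
  and E_Int: "D \<in> sets borel \<Longrightarrow> D' \<in> sets borel \<Longrightarrow> E (D \<inter> D') f = E D (E D' f)"
  and E_sums: "range DD \<subseteq> sets borel \<Longrightarrow> disjoint_family DD \<Longrightarrow> (\<lambda>n. E (DD n) f) sums E (\<Union>n. DD n) f"
  using spectral_measure by (auto simp: spectral_measure_def)

text \<open>
  The empty set is the disjoint union of infinitely many copies of itself, and the terms of a
  convergent series tend to \<open>0\<close>.
\<close>

lemma E_empty: "E {} f = 0"
proof -
  have "(\<lambda>n::nat. E {} f) sums E {} f"
    using E_sums[of "\<lambda>_. {}" f] by (simp add: disjoint_family_on_def)
  then have "(\<lambda>n::nat. E {} f) \<longlonglongrightarrow> 0"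
    by (simp add: summable_LIMSEQ_zero sums_iff)
  then show ?thesis
    by (simp add: LIMSEQ_const_iff)
qed

lemma E_Un:
  assumes "A \<in> sets borel" "B \<in> sets borel" "A \<inter> B = {}"
  shows "E (A \<union> B) f = E A f + E B f"
proof -
  have "(\<lambda>n. E (binaryset A B n) f) sums E (\<Union>n. binaryset A B n) f"
    using assms by (intro E_sums) (auto simp: binaryset_def disjoint_family_on_def)
  moreover have "(\<lambda>n. E (binaryset A B n) f) sums (E A f + E B f)"
    using sums_finite[of "{..<2}" "\<lambda>n. E (binaryset A B n) f"]
    by (simp add: binaryset_def E_empty numeral_2_eq_2)
  ultimately show ?thesis
    by (simp add: UN_binaryset_eq sums_unique2)
qed

lemma E_finite_UN:
  assumes "finite I" "\<And>i. i \<in> I \<Longrightarrow> D i \<in> sets borel" "disjoint_family_on D I"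
  shows "E (\<Union>i\<in>I. D i) f = (\<Sum>i\<in>I. E (D i) f)"
  using assms
proof (induction I rule: finite_induct)
  case empty
  then show ?case by (simp add: E_empty)
next
  case (insert a I)
  have "E (D a \<union> (\<Union>i\<in>I. D i)) f = E (D a) f + E (\<Union>i\<in>I. D i) f"
    using insert.prems insert.hyps
    by (intro E_Un sets.finite_UN) (force simp: disjoint_family_on_def)+
  moreover have "disjoint_family_on D I"
    using insert.prems(2) by (rule disjoint_family_on_mono[rotated]) auto
  ultimately show ?case
    using insert by simp
qed

text \<open>
  Call a set bad if \<open>E\<close> applied to \<open>f\<close> is unbounded on its Borel subsets. A bad set contains a set
  of large value whose complement has a large value too, and one of the two parts is bad again.
  Keeping the bad part and discarding the other one repeatedly yields disjoint sets whose values have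
  norms tending to infinity, against countable additivity.
\<close>

lemma bounded_orbit_of_E: "\<exists>c. \<forall>D\<in>sets borel. norm (E D f) \<le> c"
proof (rule ccontr)
  define unb where "unb D \<longleftrightarrow> D \<in> sets borel \<and> 
    (\<forall>c. \<exists>A\<in>sets borel. A \<subseteq> D \<and> norm (E A f) > c)" for D
  assume "\<not> ?thesis"
  then have "unb UNIV"
    by (auto simp: unb_def not_le)
  have split: "\<exists>C D'. C \<in> sets borel \<and> C \<union> D' \<subseteq> D \<and> C \<inter> D' = {} \<and> unb D' \<and> norm (E C f) > real n"
    if D: "unb D" for D n
  proof -
    have [measurable]: "D \<in> sets borel"
      using D by (simp add: unb_def)
    obtain A where A[measurable]: "A \<in> sets borel" and "A \<subseteq> D" and big: "norm (E A f) > norm (E D f) + real n"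
      using D unfolding unb_def by blast
    define B where "B = D - A"
    have B[measurable]: "B \<in> sets borel" by (simp add: B_def)
    have "A \<union> B = D" "A \<inter> B = {}" 
      using \<open>A \<subseteq> D\<close> by (auto simp: B_def)
    then have "E D f = E A f + E B f"
      using E_Un[OF A B] by auto
    then have bigB: "norm (E B f) > real n"
      using big norm_triangle_ineq4[of "E D f" "E B f"] by simp
    have bigA: "norm (E A f) > real n"
      using big norm_ge_zero[of "E D f"] by linarith
    \<comment> \<open>values on subsets of \<open>D\<close> split into values on subsets of \<open>A\<close> and of \<open>B\<close>\<close>
    have "unb A \<or> unb B"
    proof (rule ccontr)
      assume "\<not> (unb A \<or> unb B)"
      then obtain a b where a: "\<And>X. X \<in> sets borel \<Longrightarrow> X \<subseteq> A \<Longrightarrow> norm (E X f) \<le> a"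
        and b: "\<And>X. X \<in> sets borel \<Longrightarrow> X \<subseteq> B \<Longrightarrow> norm (E X f) \<le> b"
        using A B unfolding unb_def by (meson not_le)
      obtain X where X[measurable]: "X \<in> sets borel" and "X \<subseteq> D" "norm (E X f) > a + b"
        using D unfolding unb_def by blast
      have "X = (X \<inter> A) \<union> (X \<inter> B)"
        using \<open>A \<union> B = D\<close> \<open>X \<subseteq> D\<close> by auto
      then have "E X f = E (X \<inter> A) f + E (X \<inter> B) f"
        using E_Un[of "X \<inter> A" "X \<inter> B" f] \<open>A \<inter> B = {}\<close> by auto
      also have "norm \<dots> \<le> a + b"
        by (intro norm_triangle_mono a b) auto
      finally show False
        using \<open>norm (E X f) > a + b\<close> by simp
    qed
    then show ?thesis
    proof
      assume "unb A"
      then show ?thesis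
        using bigB B \<open>A \<union> B = D\<close> \<open>A \<inter> B = {}\<close> by (intro exI[of _ B] exI[of _ A]) auto
    next
      assume "unb B"
      then show ?thesis
        using bigA A \<open>A \<union> B = D\<close> \<open>A \<inter> B = {}\<close> by (intro exI[of _ A] exI[of _ B]) auto
    qed
  qed
  then obtain c d where cd: "\<And>D n. unb D \<Longrightarrow> c D n \<in> sets borel \<and> c D n \<union> d D n \<subseteq> D \<and> 
      c D n \<inter> d D n = {} \<and> unb (d D n) \<and> norm (E (c D n) f) > real n"
    by metis
  define Q where "Q = rec_nat UNIV (\<lambda>n D. d D n)"
  have Q_Suc: "Q (Suc n) = d (Q n) n" for n
    by (simp add: Q_def)
  have unb: "unb (Q n)" for n
    using \<open>unb UNIV\<close> cd by (induction n) (auto simp: Q_def)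
  have anti: "Q k \<subseteq> Q n" if "n \<le> k" for n k
    using that cd[OF unb] by (induction k rule: dec_induct) (fastforce simp: Q_Suc)+
  define C where "C n = c (Q n) n" for n
  have C: "C n \<in> sets borel" "C n \<subseteq> Q n" "C n \<inter> Q (Suc n) = {}" "norm (E (C n) f) > real n" for n
    using cd[OF unb, of n n] by (auto simp: C_def Q_Suc)
  have "C n \<inter> C k = {}" if "n < k" for n k
    using anti[of "Suc n" k] C(2)[of k] C(3)[of n] that by auto
  then have "disjoint_family C"
    unfolding disjoint_family_on_def by (metis inf_commute linorder_neqE_nat)
  then have "(\<lambda>n. E (C n) f) sums E (\<Union>n. C n) f"
    using C by (intro E_sums) auto
  then have "(\<lambda>n. E (C n) f) \<longlonglongrightarrow> 0"
    by (simp add: summable_LIMSEQ_zero sums_iff)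
  then have "eventually (\<lambda>n. norm (E (C n) f) < 1) sequentially"
    using order_tendstoD(2)[OF tendsto_norm] by fastforce
  then obtain N where "\<And>n. n \<ge> N \<Longrightarrow> norm (E (C n) f) < 1"
    by (auto simp: eventually_sequentially)
  from this[of "Suc N"] C(4)[of "Suc N"] show False
    by simp
qed

lemma E_uniformly_bounded: "\<exists>K\<ge>0. \<forall>D\<in>sets borel. \<forall>f. norm (E D f) \<le> K * norm f"
  by (intro uniform_boundedness bounded_orbit_of_E bounded_clinear_bounded_linear bounded_clinear_E)

section \<open>Integrals of simple functions\<close>

abbreviation "spectral_sum \<equiv> simple_spectral_integral E"

text \<open>
  The integral may be computed from any finite Borel partition on whose pieces the function is
  constant. This is what allows refining the partitions of two functions to a common one.
\<close>

lemma spectral_sum_partition: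
  assumes I: "finite I" and D: "\<And>i. i \<in> I \<Longrightarrow> D i \<in> sets borel"
    and disj: "disjoint_family_on D I" and cover: "(\<Union>i\<in>I. D i) = UNIV"
    and s: "\<And>i z. i \<in> I \<Longrightarrow> z \<in> D i \<Longrightarrow> s z = c i"
  shows "spectral_sum s f = (\<Sum>i\<in>I. c i *\<^sub>C E (D i) f)"
proof -
  define I' where "I' = {i\<in>I. D i \<noteq> {}}"
  have fin: "finite I'" and I'I: "I' \<subseteq> I" using I by (auto simp: I'_def)
  have range: "range s = c ` I'"
  proof (intro set_eqI iffI)
    fix v assume "v \<in> range s"
    then obtain z where "v = s z" by auto
    moreover obtain i where "i \<in> I" "z \<in> D i" using cover by blast
    ultimately show "v \<in> c ` I'"
      using s by (auto simp: I'_def)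
  next
    fix v assume "v \<in> c ` I'"
    then obtain i z where "i \<in> I" "z \<in> D i" "v = c i" by (auto simp: I'_def)
    then show "v \<in> range s" using s by (metis rangeI)
  qed
  have fib: "s -` {v} = (\<Union>i\<in>{i\<in>I'. c i = v}. D i)" for v
  proof (intro set_eqI iffI)
    fix z assume "z \<in> s -` {v}"
    moreover obtain i where "i \<in> I" "z \<in> D i" using cover by blast
    ultimately show "z \<in> (\<Union>i\<in>{i\<in>I'. c i = v}. D i)"
      using s by (auto simp: I'_def)
  qed (use s in \<open>auto simp: I'_def\<close>)
  have "E (s -` {v}) f = (\<Sum>i\<in>{i\<in>I'. c i = v}. E (D i) f)" for v
    unfolding fib using fin D I'I disj
    by (intro E_finite_UN) (auto intro: disjoint_family_on_mono[rotated])
  then have "spectral_sum s f = (\<Sum>v\<in>c ` I'. v *\<^sub>C (\<Sum>i\<in>{i\<in>I'. c i = v}. E (D i) f))"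
    by (simp add: simple_spectral_integral_def range)
  also have "\<dots> = (\<Sum>v\<in>c ` I'. \<Sum>i\<in>{i\<in>I'. c i = v}. c i *\<^sub>C E (D i) f)"
    by (simp add: scaleC.sum_right)
  also have "\<dots> = (\<Sum>i\<in>I'. c i *\<^sub>C E (D i) f)"
    by (rule sum.image_gen[OF fin, symmetric])
  also have "\<dots> = (\<Sum>i\<in>I. c i *\<^sub>C E (D i) f)"
    using I by (intro sum.mono_neutral_left) (auto simp: I'_def E_empty scaleC.zero_right)
  finally show ?thesis .
qed

lemma spectral_sum_pair:
  assumes s: "simple_function borel s" and t: "simple_function borel t"
  shows "spectral_sum (\<lambda>z. h (s z) (t z)) f = 
    (\<Sum>(a, b)\<in>range s \<times> range t. h a b *\<^sub>C E (s -` {a} \<inter> t -` {b}) f)"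
proof -
  have "spectral_sum (\<lambda>z. h (s z) (t z)) f = 
    (\<Sum>p\<in>range s \<times> range t. h (fst p) (snd p) *\<^sub>C E (s -` {fst p} \<inter> t -` {snd p}) f)"
    using simple_functionD[OF s] simple_functionD[OF t]
    by (intro spectral_sum_partition) (auto simp: disjoint_family_on_def intro!: sets.Int)
  then show ?thesis by (simp add: case_prod_beta)
qed

lemma spectral_sum_add:
  assumes "simple_function borel s" "simple_function borel t"
  shows "spectral_sum (\<lambda>z. s z + t z) f = spectral_sum s f + spectral_sum t f"
  using spectral_sum_pair[OF assms, of "(+)" f] spectral_sum_pair[OF assms, of "\<lambda>a b. a" f]
    spectral_sum_pair[OF assms, of "\<lambda>a b. b" f]
  by (simp add: scaleC_add_left sum.distrib case_prod_beta)

lemma spectral_sum_diff: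
  assumes "simple_function borel s" "simple_function borel t"
  shows "spectral_sum (\<lambda>z. s z - t z) f = spectral_sum s f - spectral_sum t f"
  using spectral_sum_pair[OF assms, of "(-)" f] spectral_sum_pair[OF assms, of "\<lambda>a b. a" f]
    spectral_sum_pair[OF assms, of "\<lambda>a b. b" f]
  by (simp add: scaleC.diff_left sum_subtractf case_prod_beta)

lemma E_scaleC: "D \<in> sets borel \<Longrightarrow> E D (c *\<^sub>C f) = c *\<^sub>C E D f"
  and E_add: "D \<in> sets borel \<Longrightarrow> E D (f + g) = E D f + E D g"
  using bounded_clinear_E by (auto intro: bounded_clinear_scaleC bounded_clinear_add)

lemma E_scaleR: "D \<in> sets borel \<Longrightarrow> E D (r *\<^sub>R f) = r *\<^sub>R E D f"
  using E_scaleC[of D "complex_of_real r" f] by (simp add: scaleC_of_real)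

lemma E_diff: "D \<in> sets borel \<Longrightarrow> E D (f - g) = E D f - E D g"
  by (simp add: bounded_clinear_diff bounded_clinear_E)

lemma E_sum: "D \<in> sets borel \<Longrightarrow> E D (sum g I) = (\<Sum>i\<in>I. E D (g i))"
  using bounded_linear.linear[OF bounded_clinear_bounded_linear[OF bounded_clinear_E]] 
  by (auto simp: linear_sum)

text \<open>
  The product rule of the spectral measure becomes multiplicativity of the integral, which passes
  to bounded functions by approximation.
\<close>

lemma spectral_sum_mult:
  assumes s: "simple_function borel s" and t: "simple_function borel t"
  shows "spectral_sum (\<lambda>z. s z * t z) f = spectral_sum s (spectral_sum t f)"
proof -
  have m: "s -` {a} \<in> sets borel" "t -` {a} \<in> sets borel" for a
    using simple_functionD(2)[OF s, of "{a}"] simple_functionD(2)[OF t, of "{a}"] by simp_all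
  have "spectral_sum s (spectral_sum t f) = (\<Sum>a\<in>range s. \<Sum>b\<in>range t. (a * b) *\<^sub>C E (s -` {a} \<inter> t -` {b}) f)"
    unfolding simple_spectral_integral_def
    using m by (simp add: E_sum E_scaleC scaleC.sum_right scaleC_scaleC E_Int)
  then show ?thesis
    using spectral_sum_pair[OF assms, of "(*)" f] by (simp add: sum.cartesian_product)
qed

lemma bounded_spectral_sum:
  "\<exists>C\<ge>0. \<forall>s B f. simple_function borel s \<longrightarrow> (\<forall>z. cmod (s z) \<le> B) \<longrightarrow> norm (spectral_sum s f) \<le> C * B * norm f"
proof -
  obtain K where K: "K \<ge> 0" "\<And>D f. D \<in> sets borel \<Longrightarrow> norm (E D f) \<le> K * norm f"
    using E_uniformly_bounded by blast
  have "norm (spectral_sum s f) \<le> 4 * K * B * norm f" 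
    if s: "simple_function borel s" and B: "\<And>z. cmod (s z) \<le> B" for s B f
  proof -
    have m: "s -` {a} \<in> sets borel" for a
      using simple_functionD(2)[OF s, of "{a}"] by simp
    have fin: "finite (range s)"
      using simple_functionD(1)[OF s] by simp
    have "0 \<le> B"
      using B[of 0] norm_ge_zero order_trans by blast
    have "norm (spectral_sum s f) \<le> 4 * B * (K * norm f)"
      unfolding simple_spectral_integral_def
    proof (rule norm_sum_scaleC_le)
      fix J assume J: "J \<subseteq> range s"
      have "(\<Sum>a\<in>J. E (s -` {a}) f) = E (\<Union>a\<in>J. s -` {a}) f"
        using m finite_subset[OF J fin] 
        by (intro E_finite_UN[symmetric]) (auto simp: disjoint_family_on_def)
      also have "norm \<dots> \<le> K * norm f"
        using m finite_subset[OF J fin] by (intro K sets.finite_UN) auto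
      finally show "norm (\<Sum>a\<in>J. E (s -` {a}) f) \<le> K * norm f" .
    qed (use B fin \<open>0 \<le> B\<close> in auto)
    then show ?thesis by (simp add: mult_ac)
  qed
  then show ?thesis
    using K(1) by (intro exI[of _ "4 * K"]) auto
qed

text \<open>
  One constant for all functions and vectors. It is chosen once, so that later estimates
  can name it.
\<close>

definition calculus_bound :: real where
  "calculus_bound = (SOME C. C \<ge> 0 \<and> (\<forall>s B f. simple_function borel s \<longrightarrow> (\<forall>z. cmod (s z) \<le> B) \<longrightarrow> norm (spectral_sum s f) \<le> C * B * norm f))"

lemma calculus_bound_nonneg: "calculus_bound \<ge> 0" and 
  norm_spectral_sum_le: "simple_function borel s \<Longrightarrow> (\<And>z. cmod (s z) \<le> B) \<Longrightarrow> norm (spectral_sum s f) \<le> calculus_bound * B * norm f"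
  using someI_ex[OF bounded_spectral_sum] unfolding calculus_bound_def[symmetric] by auto

section \<open>The bounded functional calculus\<close>

text \<open>
  Cauchy criterion for the integrals of uniform approximations. It serves both for the existence
  of the limit and for its independence of the approximating sequence.
\<close>

lemma spectral_sum_close:
  assumes "e > 0"
  shows "\<exists>d>0. \<forall>s t. simple_function borel s \<longrightarrow> simple_function borel t \<longrightarrow> 
    (\<forall>z. dist (s z) (G z) < d) \<longrightarrow> (\<forall>z. dist (t z) (G z) < d) \<longrightarrow> dist (spectral_sum s f) (spectral_sum t f) < e"
proof -
  \<comment> \<open>the summand \<open>1\<close> keeps the denominator positive when \<open>f = 0\<close>\<close>
  define d where "d = e / (2 * (calculus_bound * norm f + 1))"
  have pos: "calculus_bound * norm f + 1 > 0"
    using calculus_bound_nonneg by (simp add: add_nonneg_pos)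
  then have "d > 0" using assms by (simp add: d_def)
  moreover have "dist (spectral_sum s f) (spectral_sum t f) < e" if s: "simple_function borel s" and t: "simple_function borel t"
    and sd: "\<And>z. dist (s z) (G z) < d" and td: "\<And>z. dist (t z) (G z) < d" for s t
  proof -
    have "cmod (s z - t z) \<le> 2 * d" for z
      using dist_triangle2[of "s z" "t z" "G z"] sd[of z] td[of z] by (simp add: dist_norm)
    then have "norm (spectral_sum (\<lambda>z. s z - t z) f) \<le> calculus_bound * (2 * d) * norm f"
      by (intro norm_spectral_sum_le simple_function_diff s t)
    also have "\<dots> = (calculus_bound * norm f) * (2 * d)" by simp
    also have "\<dots> < (calculus_bound * norm f + 1) * (2 * d)"
      using \<open>d > 0\<close> by (intro mult_strict_right_mono) auto
    also have "\<dots> = e"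
      using pos by (simp add: d_def field_simps)
    finally show ?thesis
      by (simp add: spectral_sum_diff[OF s t] dist_norm)
  qed
  ultimately show ?thesis by blast
qed

abbreviation "bounded_integral \<equiv> bounded_spectral_integral E"

text \<open>
  This justifies the definite description in the definition of the integral: any sequence of
  simple functions converging uniformly may be used to compute it.
\<close>

lemma bounded_integral_limit:
  assumes s: "\<And>n. simple_function borel (s n)" and U: "uniform_limit UNIV s G sequentially"
  shows "(\<lambda>n. spectral_sum (s n) f) \<longlonglongrightarrow> bounded_integral G f"
proof -
  have ev: "\<exists>N. \<forall>n\<ge>N. \<forall>z. dist (t n z) (G z) < d" 
    if "uniform_limit UNIV t G sequentially" "d > 0" for t and d :: real
    using uniform_limitD[OF that] by (simp add: eventually_sequentially)
  have "Cauchy (\<lambda>n. spectral_sum (s n) f)"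
  proof (rule metric_CauchyI)
    fix e :: real assume "e > 0"
    then obtain d where "d > 0" and d: "\<And>s t. simple_function borel s \<Longrightarrow> simple_function borel t \<Longrightarrow> 
      (\<And>z. dist (s z) (G z) < d) \<Longrightarrow> (\<And>z. dist (t z) (G z) < d) \<Longrightarrow> dist (spectral_sum s f) (spectral_sum t f) < e"
      using spectral_sum_close[of e G f] by blast
    with ev[OF U \<open>d > 0\<close>] show "\<exists>M. \<forall>m\<ge>M. \<forall>n\<ge>M. dist (spectral_sum (s m) f) (spectral_sum (s n) f) < e"
      using s by (meson d)
  qed
  then obtain y where y: "(\<lambda>n. spectral_sum (s n) f) \<longlonglongrightarrow> y"
    by (meson Cauchy_convergent convergent_def)
  have unique: "y' = y" if t: "\<And>n. simple_function borel (t n)" "uniform_limit UNIV t G sequentially"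
    "(\<lambda>n. spectral_sum (t n) f) \<longlonglongrightarrow> y'" for y' t
  proof -
    have "(\<lambda>n. dist (spectral_sum (t n) f) (spectral_sum (s n) f)) \<longlonglongrightarrow> 0"
    proof (rule metric_LIMSEQ_I)
      fix e :: real assume "e > 0"
      then obtain d where "d > 0" and d: "\<And>s t. simple_function borel s \<Longrightarrow> simple_function borel t \<Longrightarrow> 
        (\<And>z. dist (s z) (G z) < d) \<Longrightarrow> (\<And>z. dist (t z) (G z) < d) \<Longrightarrow> dist (spectral_sum s f) (spectral_sum t f) < e"
        using spectral_sum_close[of e G f] by blast
      obtain N N' where "\<And>n z. n \<ge> N \<Longrightarrow> dist (s n z) (G z) < d" "\<And>n z. n \<ge> N' \<Longrightarrow> dist (t n z) (G z) < d"
        using ev[OF U \<open>d > 0\<close>] ev[OF t(2) \<open>d > 0\<close>] by blast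
      then show "\<exists>no. \<forall>n\<ge>no. dist (dist (spectral_sum (t n) f) (spectral_sum (s n) f)) 0 < e"
        using d s t(1) by (intro exI[of _ "max N N'"]) (simp add: dist_norm)
    qed
    moreover have "(\<lambda>n. dist (spectral_sum (t n) f) (spectral_sum (s n) f)) \<longlonglongrightarrow> dist y' y"
      by (intro tendsto_dist t y)
    ultimately show ?thesis
      using LIMSEQ_unique by fastforce
  qed
  have "bounded_integral G f = y"
    unfolding bounded_spectral_integral_def
    using s U y unique by (intro the_equality) blast+
  then show ?thesis using y by simp
qed

lemma bounded_integral_simple: "simple_function borel s \<Longrightarrow> bounded_integral s f = spectral_sum s f"
  using bounded_integral_limit[of "\<lambda>_. s" s f] by (simp add: LIMSEQ_const_iff uniform_limit_const)

lemma bounded_integral_norm_le: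
  assumes G: "G \<in> borel_measurable borel" and B: "\<And>z. cmod (G z) \<le> B"
  shows "norm (bounded_integral G f) \<le> calculus_bound * B * norm f"
proof -
  obtain s where s: "\<And>n. simple_function borel (s n)" and d: "\<And>n z. cmod (s n z - G z) \<le> 2 / Suc n"
    using uniform_simple_approximation[OF G B] by blast
  have "(\<lambda>n. norm (spectral_sum (s n) f)) \<longlonglongrightarrow> norm (bounded_integral G f)"
    by (intro tendsto_norm bounded_integral_limit s uniform_limit_rate d)
  moreover have "(\<lambda>n. calculus_bound * (B + 2 * inverse (real (Suc n))) * norm f) \<longlonglongrightarrow> calculus_bound * (B + 2 * 0) * norm f"
    by (intro tendsto_intros LIMSEQ_inverse_real_of_nat)
  moreover have "norm (spectral_sum (s n) f) \<le> calculus_bound * (B + 2 * inverse (real (Suc n))) * norm f" for n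
  proof (rule norm_spectral_sum_le[OF s])
    fix z
    show "cmod (s n z) \<le> B + 2 * inverse (real (Suc n))"
      using norm_triangle_ineq[of "s n z - G z" "G z"] d[of n z] B[of z] by (simp add: divide_inverse)
  qed
  ultimately show ?thesis
    using LIMSEQ_le[of _ "norm (bounded_integral G f)"] by fastforce
qed

definition "bounded_borel G \<longleftrightarrow> G \<in> borel_measurable borel \<and> (\<exists>B. \<forall>z::complex. cmod (G z) \<le> B)"

lemma bounded_borel_approximation:
  assumes "bounded_borel G"
  obtains s where "\<And>n. simple_function borel (s n)" "uniform_limit UNIV s G sequentially"
  using uniform_simple_approximation assms uniform_limit_rate unfolding bounded_borel_def by metis

lemma bounded_borel_bounded: "bounded_borel G \<Longrightarrow> bounded (range G)"
  by (auto simp: bounded_borel_def bounded_iff)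

lemma bounded_integral_add:
  assumes "bounded_borel G" "bounded_borel H"
  shows "bounded_integral (\<lambda>z. G z + H z) f = bounded_integral G f + bounded_integral H f"
proof -
  obtain s t where s: "\<And>n. simple_function borel (s n)" "uniform_limit UNIV s G sequentially"
    and t: "\<And>n. simple_function borel (t n)" "uniform_limit UNIV t H sequentially"
    using assms bounded_borel_approximation by metis
  have "(\<lambda>n. spectral_sum (\<lambda>z. s n z + t n z) f) \<longlonglongrightarrow> bounded_integral (\<lambda>z. G z + H z) f"
    by (intro bounded_integral_limit simple_function_add uniform_limit_add s t)
  moreover have "(\<lambda>n. spectral_sum (s n) f + spectral_sum (t n) f) \<longlonglongrightarrow> bounded_integral G f + bounded_integral H f"
    by (intro tendsto_add bounded_integral_limit s t)
  ultimately show ?thesis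
    using LIMSEQ_unique by (simp add: spectral_sum_add s t)
qed

lemma spectral_sum_bounded_clinear:
  assumes s: "simple_function borel s"
  shows "bounded_clinear (spectral_sum s)"
proof -
  obtain B where B: "\<And>z. cmod (s z) \<le> B"
    using simple_functionD(1)[OF s] finite_imp_bounded[of "range s"] unfolding bounded_iff by auto
  have m: "s -` {a} \<in> sets borel" for a
    using simple_functionD(2)[OF s, of "{a}"] by simp
  show ?thesis
  proof (rule bounded_clinearI)
    show "norm (spectral_sum s x) \<le> calculus_bound * B * norm x" for x
      by (rule norm_spectral_sum_le[OF s B])
  qed (simp_all add: simple_spectral_integral_def E_add m E_scaleC scaleC_add_right sum.distrib 
      scaleC.sum_right scaleC_scaleC mult.commute)
qed

lemma bounded_integral_bounded_clinear:
  assumes G: "bounded_borel G"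
  shows "bounded_clinear (bounded_integral G)"
proof -
  obtain B where B: "\<And>z. cmod (G z) \<le> B" and m: "G \<in> borel_measurable borel"
    using G by (auto simp: bounded_borel_def)
  obtain s where s: "\<And>n. simple_function borel (s n)" "uniform_limit UNIV s G sequentially"
    using bounded_borel_approximation[OF G] by blast
  note lim = bounded_integral_limit[OF s] and lin = spectral_sum_bounded_clinear[OF s(1)]
  show ?thesis
  proof (rule bounded_clinearI)
    show "bounded_integral G (x + y) = bounded_integral G x + bounded_integral G y" for x y
      using LIMSEQ_unique[OF lim[of "x + y"]] tendsto_add[OF lim[of x] lim[of y]]
      by (simp add: bounded_clinear_add[OF lin])
    show "bounded_integral G (c *\<^sub>C x) = c *\<^sub>C bounded_integral G x" for c x
      using LIMSEQ_unique[OF lim[of "c *\<^sub>C x"]] scaleC.tendsto[OF tendsto_const lim[of x]]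
      by (simp add: bounded_clinear_scaleC[OF lin])
    show "norm (bounded_integral G x) \<le> calculus_bound * B * norm x" for x
      by (rule bounded_integral_norm_le[OF m B])
  qed
qed

lemma bounded_integral_mult:
  assumes "bounded_borel G" "bounded_borel H"
  shows "bounded_integral (\<lambda>z. G z * H z) f = bounded_integral G (bounded_integral H f)"
proof -
  obtain s t where s: "\<And>n. simple_function borel (s n)" "uniform_limit UNIV s G sequentially"
    and t: "\<And>n. simple_function borel (t n)" "uniform_limit UNIV t H sequentially"
    using assms bounded_borel_approximation by metis
  obtain B where B: "\<And>z. cmod (G z) \<le> B"
    using assms by (auto simp: bounded_borel_def)
  have "(\<lambda>n. spectral_sum (\<lambda>z. s n z * t n z) f) \<longlonglongrightarrow> bounded_integral (\<lambda>z. G z * H z) f"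
    using assms bounded_borel_bounded by (intro bounded_integral_limit simple_function_mult uniform_lim_mult s t) auto
  then have "(\<lambda>n. spectral_sum (s n) (spectral_sum (t n) f)) \<longlonglongrightarrow> bounded_integral (\<lambda>z. G z * H z) f"
    by (simp add: spectral_sum_mult s t)
  moreover have "(\<lambda>n. spectral_sum (s n) (spectral_sum (t n) f)) \<longlonglongrightarrow> bounded_integral G (bounded_integral H f)"
  proof -
    have "eventually (\<lambda>n. \<forall>z. dist (s n z) (G z) < 1) sequentially"
      using uniform_limitD[OF s(2), of 1] by simp
    then have "eventually (\<lambda>n. norm (spectral_sum (s n) (spectral_sum (t n) f - bounded_integral H f)) \<le> norm (spectral_sum (t n) f - bounded_integral H f) * (calculus_bound * (B + 1))) sequentially"
    proof (rule eventually_mono)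
      fix n assume n: "\<forall>z. dist (s n z) (G z) < 1"
      have "cmod (s n z) \<le> B + 1" for z
        using norm_triangle_ineq[of "s n z - G z" "G z"] n[rule_format, of z] B[of z] by (simp add: dist_norm)
      from norm_spectral_sum_le[OF s(1) this, of "spectral_sum (t n) f - bounded_integral H f"]
      show "norm (spectral_sum (s n) (spectral_sum (t n) f - bounded_integral H f)) \<le> norm (spectral_sum (t n) f - bounded_integral H f) * (calculus_bound * (B + 1))"
        by (simp only: mult.commute)
    qed
    moreover have "(\<lambda>n. spectral_sum (t n) f - bounded_integral H f) \<longlonglongrightarrow> 0"
      by (rule LIM_zero[OF bounded_integral_limit[OF t]])
    ultimately have "(\<lambda>n. spectral_sum (s n) (spectral_sum (t n) f - bounded_integral H f)) \<longlonglongrightarrow> 0"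
      by (rule tendsto_0_le[rotated])
    from tendsto_add[OF this bounded_integral_limit[OF s, of "bounded_integral H f"]]
    show ?thesis
      by (simp add: bounded_clinear_diff[OF spectral_sum_bounded_clinear[OF s(1)]])
  qed
  ultimately show ?thesis
    by (rule LIMSEQ_unique)
qed

lemma bounded_integral_const: "bounded_integral (\<lambda>_. c) f = c *\<^sub>C f"
  by (simp add: bounded_integral_simple simple_spectral_integral_def E_UNIV)

lemma bounded_integral_indicator: 
  assumes D: "D \<in> sets borel"
  shows "bounded_integral (indicator D) f = E D f"
proof -
  have "bounded_integral (indicator D) f = spectral_sum (indicator D) f"
    using D by (intro bounded_integral_simple simple_function_indicator) simp
  also have "\<dots> = (\<Sum>i\<in>{True, False}. (if i then 1 else 0) *\<^sub>C E (if i then D else - D) f)"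
    using D by (intro spectral_sum_partition) (auto simp: disjoint_family_on_def indicator_def split: if_splits)
  finally show ?thesis
    by (simp add: scaleC.zero_left)
qed

text \<open>
  The integral over \<open>D\<close>. Integrands such as \<open>z\<close> or \<open>exp (t z)\<close> are bounded only on a part of the
  plane, so the domain of integration belongs to the notation.
\<close>

definition integral_on where
  "integral_on D G = bounded_integral (\<lambda>z. indicator D z * G z)"

definition "bounded_borel_on D G \<longleftrightarrow> 
   D \<in> sets borel \<and> G \<in> borel_measurable borel \<and> (\<exists>B. \<forall>z\<in>D. cmod (G z) \<le> B)"

lemma bounded_borel_cut: 
  assumes "bounded_borel_on D G"
  shows "bounded_borel (\<lambda>z. indicator D z * G z)"
proof -
  obtain B where B: "\<And>z. z \<in> D \<Longrightarrow> cmod (G z) \<le> B"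
    and [measurable]: "D \<in> sets borel" "G \<in> borel_measurable borel"
    using assms by (auto simp: bounded_borel_on_def)
  have "cmod (indicator D z * G z) \<le> max B 0" for z
    using B[of z] by (auto simp: indicator_def)
  moreover have "(\<lambda>z. indicator D z * G z) \<in> borel_measurable borel"
    by measurable
  ultimately show ?thesis
    unfolding bounded_borel_def by blast
qed

lemma bounded_borel_on_subset: 
  "bounded_borel_on D G \<Longrightarrow> D' \<subseteq> D \<Longrightarrow> D' \<in> sets borel \<Longrightarrow> bounded_borel_on D' G"
  unfolding bounded_borel_on_def by blast

lemma bounded_borel_on_const: "D \<in> sets borel \<Longrightarrow> bounded_borel_on D (\<lambda>_. c)"
  by (auto simp: bounded_borel_on_def)

lemma integral_on_norm_le:
  assumes [measurable]: "D \<in> sets borel" "G \<in> borel_measurable borel" 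
    and B: "\<And>z. z \<in> D \<Longrightarrow> cmod (G z) \<le> B" "0 \<le> B"
  shows "norm (integral_on D G f) \<le> calculus_bound * B * norm f"
  unfolding integral_on_def using B by (intro bounded_integral_norm_le) (auto simp: indicator_def)

lemma integral_on_bounded_clinear: "bounded_borel_on D G \<Longrightarrow> bounded_clinear (integral_on D G)"
  unfolding integral_on_def by (intro bounded_integral_bounded_clinear bounded_borel_cut)

lemma integral_on_cong:
  "(\<And>z. z \<in> D \<Longrightarrow> G z = H z) \<Longrightarrow> integral_on D G = integral_on D H"
  unfolding integral_on_def by (intro arg_cong[of _ _ bounded_integral]) (auto simp: indicator_def)

lemma integral_on_one: "D \<in> sets borel \<Longrightarrow> integral_on D (\<lambda>_. 1) f = E D f"
  by (simp add: integral_on_def bounded_integral_indicator)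

lemma integral_on_mult:
  assumes "bounded_borel_on D G" "bounded_borel_on D' H"
  shows "integral_on D G (integral_on D' H f) = integral_on (D \<inter> D') (\<lambda>z. G z * H z) f"
proof -
  have "(\<lambda>z. indicator D z * G z * (indicator D' z * H z)) = (\<lambda>z. indicator (D \<inter> D') z * (G z * H z))"
    by (auto simp: indicator_def fun_eq_iff)
  then show ?thesis
    unfolding integral_on_def by (simp add: assms bounded_borel_cut flip: bounded_integral_mult)
qed

lemma integral_on_E:
  assumes "bounded_borel_on D G" "D' \<in> sets borel"
  shows "integral_on D G (E D' f) = integral_on (D \<inter> D') G f" 
    and "E D' (integral_on D G f) = integral_on (D \<inter> D') G f"
  using integral_on_mult[OF assms(1) bounded_borel_on_const[OF assms(2)], of 1 f]
    integral_on_mult[OF bounded_borel_on_const[OF assms(2)] assms(1), of 1 f]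
  by (simp_all add: integral_on_one assms Int_commute)

lemma integral_on_add:
  assumes "bounded_borel_on D G" "bounded_borel_on D H"
  shows "integral_on D (\<lambda>z. G z + H z) f = integral_on D G f + integral_on D H f"
  unfolding integral_on_def 
  by (simp only: distrib_left bounded_integral_add[OF bounded_borel_cut[OF assms(1)] bounded_borel_cut[OF assms(2)]])

lemma integral_on_scaleC:
  assumes "bounded_borel_on D G"
  shows "integral_on D (\<lambda>z. c * G z) f = c *\<^sub>C integral_on D G f"
proof -
  have "bounded_borel_on UNIV (\<lambda>_. c)"
    by (simp add: bounded_borel_on_const)
  from integral_on_mult[OF this assms, of f] show ?thesis
    by (simp add: integral_on_def[of UNIV] bounded_integral_const)
qed

lemma bounded_borel_on_mult: 
  assumes "bounded_borel_on D G" "bounded_borel_on D H" 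
  shows "bounded_borel_on D (\<lambda>z. G z * H z)"
proof -
  obtain B B' where "\<And>z. z \<in> D \<Longrightarrow> cmod (G z) \<le> B" "\<And>z. z \<in> D \<Longrightarrow> cmod (H z) \<le> B'"
    using assms by (auto simp: bounded_borel_on_def)
  then have "\<forall>z\<in>D. cmod (G z * H z) \<le> B * B'"
    unfolding norm_mult by (meson mult_mono' norm_ge_zero)
  then show ?thesis
    using assms by (auto simp: bounded_borel_on_def)
qed

lemma bounded_borel_on_add: 
  assumes "bounded_borel_on D G" "bounded_borel_on D H" 
  shows "bounded_borel_on D (\<lambda>z. G z + H z)"
proof -
  obtain B B' where "\<And>z. z \<in> D \<Longrightarrow> cmod (G z) \<le> B" "\<And>z. z \<in> D \<Longrightarrow> cmod (H z) \<le> B'"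
    using assms by (auto simp: bounded_borel_on_def)
  then have "\<forall>z\<in>D. cmod (G z + H z) \<le> B + B'"
    by (meson norm_triangle_mono)
  then show ?thesis
    using assms by (auto simp: bounded_borel_on_def)
qed

lemma integral_on_diff:
  assumes "bounded_borel_on D G" "bounded_borel_on D H"
  shows "integral_on D (\<lambda>z. G z - H z) f = integral_on D G f - integral_on D H f"
  using integral_on_add[OF assms(1) bounded_borel_on_mult[OF bounded_borel_on_const assms(2)], of "-1" f]
    integral_on_scaleC[OF assms(2), of "-1" f] assms
  by (auto simp: bounded_borel_on_def scaleC.minus_left)

lemma integral_on_Un:
  assumes "bounded_borel_on D G" "D = A \<union> B" "A \<inter> B = {}" "A \<in> sets borel" "B \<in> sets borel"
  shows "integral_on D G f = integral_on A G f + integral_on B G f"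
proof -
  have "(\<lambda>z. indicator D z * G z) = (\<lambda>z. indicator A z * G z + indicator B z * G z)"
    using assms by (auto simp: indicator_def fun_eq_iff)
  then show ?thesis
    unfolding integral_on_def
    using assms bounded_integral_add[OF bounded_borel_cut[of A G] bounded_borel_cut[of B G]] bounded_borel_on_subset[of D G]
    by simp
qed

section \<open>Dominated convergence\<close>

text \<open>
  Continuity from above at the empty set, by telescoping over the successive differences.
\<close>

lemma E_decseq:
  assumes D: "\<And>n. D n \<in> sets borel" and dec: "decseq D" and empty: "(\<Inter>n. D n) = {}"
  shows "(\<lambda>n. E (D n) f) \<longlonglongrightarrow> 0"
proof -
  have sub: "D (Suc n) \<subseteq> D n" for n
    using dec by (simp add: decseq_SucD)
  have "(D n - D (Suc n)) \<inter> (D k - D (Suc k)) = {}" if "n < k" for n k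
    using decseqD[OF dec, of "Suc n" k] that by auto
  then have "disjoint_family (\<lambda>n. D n - D (Suc n))"
    unfolding disjoint_family_on_def using decseqD[OF dec]
    by (smt (verit, best) Diff_iff Suc_leI disjoint_iff linorder_neqE_nat subsetD)
  then have "(\<lambda>n. E (D n - D (Suc n)) f) sums E (\<Union>n. D n - D (Suc n)) f"
    using D by (intro E_sums) auto
  moreover have "(\<Union>n. D n - D (Suc n)) = D 0"
  proof (intro equalityI subsetI)
    fix z assume "z \<in> D 0"
    show "z \<in> (\<Union>n. D n - D (Suc n))"
    proof (rule ccontr)
      assume "z \<notin> (\<Union>n. D n - D (Suc n))"
      then have "z \<in> D n" for n
        using \<open>z \<in> D 0\<close> by (induction n) auto
      then show False using empty by blast
    qed
  qed (use decseqD[OF dec, of 0] in auto)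
  moreover have "(\<Sum>n<N. E (D n - D (Suc n)) f) = E (D 0) f - E (D N) f" for N
  proof (induction N)
    case (Suc N)
    have "E (D N) f = E (D N - D (Suc N)) f + E (D (Suc N)) f"
      using E_Un[of "D N - D (Suc N)" "D (Suc N)" f] sub[of N] D by (simp add: Diff_Int_distrib2 Un_absorb2)
    then show ?case using Suc by simp
  qed simp
  ultimately have "(\<lambda>N. E (D 0) f - E (D N) f) \<longlonglongrightarrow> E (D 0) f"
    by (simp add: sums_def)
  from tendsto_diff[OF tendsto_const this, of "E (D 0) f"] show ?thesis
    by simp
qed

text \<open>
  The set where some later member of the sequence is still \<open>d\<close>-far from the limit
  decreases to the empty set. Its projection of \<open>h\<close> is therefore small, which controls the integral
  over it by the uniform bound; off this set convergence is uniform. The vectors may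
  vary with \<open>n\<close> because the operators are uniformly bounded.
\<close>

theorem dominated_convergence:
  assumes D[measurable]: "D \<in> sets borel" and G[measurable]: "\<And>n. G n \<in> borel_measurable borel"
    and G0[measurable]: "G0 \<in> borel_measurable borel"
    and B: "\<And>n z. z \<in> D \<Longrightarrow> cmod (G n z) \<le> B"
    and lim: "\<And>z. z \<in> D \<Longrightarrow> (\<lambda>n. G n z) \<longlonglongrightarrow> G0 z"
    and g: "g \<longlonglongrightarrow> h"
  shows "(\<lambda>n. integral_on D (G n) (g n)) \<longlonglongrightarrow> integral_on D G0 h"
proof -
  define B' where "B' = max B 0"
  have B': "cmod (G n z) \<le> B'" if "z \<in> D" for n z
    using B[OF that, of n] by (simp add: B'_def)
  have B0: "cmod (G0 z) \<le> B'" if "z \<in> D" for z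
    using LIMSEQ_le_const2[OF tendsto_norm[OF lim[OF that]]] B'[OF that] by blast
  have ok: "bounded_borel_on D (G n)" "bounded_borel_on D G0" for n
    using B' B0 by (auto simp: bounded_borel_on_def)
  define H where "H n z = G n z - G0 z" for n z
  have [measurable]: "H n \<in> borel_measurable borel" for n
    unfolding H_def by measurable
  have H: "cmod (H n z) \<le> 2 * B'" if "z \<in> D" for n z
    using norm_triangle_ineq4[of "G n z" "G0 z"] B'[OF that, of n] B0[OF that] by (simp add: H_def)
  then have okH: "bounded_borel_on D (H n)" for n
    by (auto simp: bounded_borel_on_def)
  have H_lim: "(\<lambda>n. integral_on D (H n) h) \<longlonglongrightarrow> 0"
  proof (rule metric_LIMSEQ_I)
    fix e :: real assume "e > 0"
    define d where "d = e / (2 * (calculus_bound * norm h + 1))"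
    have pos: "calculus_bound * norm h + 1 > 0"
      using calculus_bound_nonneg by (simp add: add_nonneg_pos)
    then have "d > 0" using \<open>e > 0\<close> by (simp add: d_def)
    \<comment> \<open>the exceptional sets of an Egorov argument, for all indices from \<open>N\<close> on at once\<close>
    define bad where "bad N = {z\<in>D. \<exists>n\<ge>N. cmod (H n z) > d}" for N
    have [measurable]: "bad N \<in> sets borel" for N
      unfolding bad_def by measurable
    have "(\<lambda>N. E (bad N) h) \<longlonglongrightarrow> 0"
    proof (rule E_decseq)
      show "decseq bad"
        by (auto simp: decseq_def bad_def intro: order_trans)
      have "z \<notin> (\<Inter>N. bad N)" for z
      proof
        assume z: "z \<in> (\<Inter>N. bad N)"
        then have "z \<in> D" by (auto simp: bad_def)
        from LIM_zero[OF lim[OF this]] obtain N where "\<And>n. n \<ge> N \<Longrightarrow> cmod (H n z) < d"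
          using \<open>d > 0\<close> unfolding H_def LIMSEQ_iff by auto
        then show False
          using z by (force simp: bad_def)
      qed
      then show "(\<Inter>N. bad N) = {}" by blast
    qed measurable
    then have "(\<lambda>N. calculus_bound * (2 * B') * norm (E (bad N) h)) \<longlonglongrightarrow> calculus_bound * (2 * B') * 0"
      by (intro tendsto_mult_left tendsto_norm_zero)
    then have "eventually (\<lambda>N. calculus_bound * (2 * B') * norm (E (bad N) h) < e / 2) sequentially"
      using \<open>e > 0\<close> by (intro order_tendstoD(2)) auto
    then obtain N where N: "calculus_bound * (2 * B') * norm (E (bad N) h) < e / 2"
      by (auto simp: eventually_sequentially)
    have "dist (integral_on D (H n) h) 0 < e" if "n \<ge> N" for n
    proof -
      have "bad N \<subseteq> D" by (auto simp: bad_def)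
      have "integral_on D (H n) h = integral_on (D - bad N) (H n) h + integral_on (bad N) (H n) h"
        using \<open>bad N \<subseteq> D\<close> by (intro integral_on_Un okH) auto
      also have "integral_on (bad N) (H n) h = integral_on D (H n) (E (bad N) h)"
        using integral_on_E(1)[OF okH, of "bad N"] \<open>bad N \<subseteq> D\<close> by (simp add: Int_absorb1)
      also have "norm (integral_on (D - bad N) (H n) h + integral_on D (H n) (E (bad N) h))
         \<le> calculus_bound * d * norm h + calculus_bound * (2 * B') * norm (E (bad N) h)"
        using \<open>d > 0\<close> that H
        by (intro norm_triangle_mono integral_on_norm_le) (auto simp: bad_def B'_def not_less)
      also have "calculus_bound * d * norm h \<le> e / 2"
      proof -
        have "calculus_bound * d * norm h \<le> d * (calculus_bound * norm h + 1)"
          using \<open>d > 0\<close> by (simp add: algebra_simps)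
        also have "\<dots> = e / 2"
        proof -
          have "e / (2 * r) * r = e / 2" if "r > 0" for r :: real
            using that by simp
          from this[OF pos] show ?thesis by (simp only: d_def)
        qed
        finally show ?thesis .
      qed
      finally show ?thesis using N by simp
    qed
    then show "\<exists>N. \<forall>n\<ge>N. dist (integral_on D (H n) h) 0 < e" by blast
  qed
  have "(\<lambda>n. integral_on D (G n) (g n - h)) \<longlonglongrightarrow> 0"
  proof (rule tendsto_0_le[of "\<lambda>n. g n - h" _ _ "calculus_bound * B'"])
    show "\<forall>\<^sub>F n in sequentially. norm (integral_on D (G n) (g n - h)) \<le> norm (g n - h) * (calculus_bound * B')"
      using integral_on_norm_le[OF D G B'] by (auto simp: B'_def mult.commute)
    show "(\<lambda>n. g n - h) \<longlonglongrightarrow> 0"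
      by (rule LIM_zero[OF g])
  qed
  moreover have "integral_on D (G n) (g n) = integral_on D (G n) (g n - h) + integral_on D (H n) h + integral_on D G0 h" for n
    unfolding H_def by (simp add: integral_on_diff ok bounded_clinear_diff[OF integral_on_bounded_clinear])
  ultimately show ?thesis
    using tendsto_add[OF tendsto_add[OF _ H_lim] tendsto_const] by fastforce
qed

text \<open>
  A real parameter instead of a sequence, which is the form needed for continuity and derivatives
  in time.
\<close>

corollary dominated_convergence_at:
  fixes G :: "real \<Rightarrow> complex \<Rightarrow> complex"
  assumes D: "D \<in> sets borel" and G: "\<And>s. G s \<in> borel_measurable borel" "G0 \<in> borel_measurable borel"
    and B: "eventually (\<lambda>s. \<forall>z\<in>D. cmod (G s z) \<le> B) (at t within X)"
    and lim: "\<And>z. z \<in> D \<Longrightarrow> ((\<lambda>s. G s z) \<longlongrightarrow> G0 z) (at t within X)"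
    and g: "(g \<longlongrightarrow> h) (at t within X)"
  shows "((\<lambda>s. integral_on D (G s) (g s)) \<longlongrightarrow> integral_on D G0 h) (at t within X)"
  unfolding tendsto_at_iff_sequentially
proof (intro allI impI)
  fix u :: "nat \<Rightarrow> real" assume "\<forall>i. u i \<in> X - {t}" "u \<longlonglongrightarrow> t"
  then have u: "filterlim u (at t within X) sequentially"
    by (auto simp: filterlim_at)
  from eventually_compose_filterlim[OF B u] obtain N where N: "\<And>n z. n \<ge> N \<Longrightarrow> z \<in> D \<Longrightarrow> cmod (G (u n) z) \<le> B"
    by (auto simp: eventually_sequentially)
  have "(\<lambda>n. integral_on D (G (u (n + N))) (g (u (n + N)))) \<longlonglongrightarrow> integral_on D G0 h"
    using D G N by (intro dominated_convergence[where B = B] LIMSEQ_ignore_initial_segment)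
      (auto intro: filterlim_compose[OF lim u] filterlim_compose[OF g u])
  then show "((\<lambda>s. integral_on D (G s) (g s)) \<circ> u) \<longlonglongrightarrow> integral_on D G0 h"
    unfolding o_def by (rule LIMSEQ_offset)
qed

end

section \<open>Derivatives of exponential families\<close>

lemma has_vector_derivative_iff_quotient:
  fixes f :: "real \<Rightarrow> 'b::real_normed_vector"
  shows "(f has_vector_derivative D) (at t within X) \<longleftrightarrow>
    ((\<lambda>s. (f s - f t) /\<^sub>R (s - t)) \<longlongrightarrow> D) (at t within X)"
proof -
  have "norm (f s - f t - (s - t) *\<^sub>R D) / norm (s - t) = norm ((f s - f t) /\<^sub>R (s - t) - D)" if "s \<noteq> t" for s
  proof -
    have "f s - f t - (s - t) *\<^sub>R D = (s - t) *\<^sub>R ((f s - f t) /\<^sub>R (s - t) - D)"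
      using that by (simp add: scaleR_diff_right)
    then show ?thesis
      using that by (simp only: norm_scaleR) simp
  qed
  then have "eventually (\<lambda>s. norm (f s - f t - (s - t) *\<^sub>R D) / norm (s - t) = norm ((f s - f t) /\<^sub>R (s - t) - D)) (at t within X)"
    by (auto simp: eventually_at_filter)
  then show ?thesis
    unfolding has_vector_derivative_def has_derivative_iff_norm
    by (simp add: bounded_linear_scaleR_left tendsto_norm_zero_iff LIM_zero_iff cong: tendsto_cong)
qed

text \<open>
  Mean value inequality along the segment from \<open>t z\<close> to \<open>s z\<close>, on which the real part stays between
  those of the endpoints. It dominates difference quotients by values of the exponential
  at the two times.
\<close>

lemma norm_exp_quotient_le:
  assumes "s \<noteq> t"
  shows "cmod ((exp (s *\<^sub>R z) - exp (t *\<^sub>R z)) /\<^sub>R (s - t)) \<le> cmod z * max (exp (s * Re z)) (exp (t * Re z))"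
proof -
  define M where "M = max (exp (s * Re z)) (exp (t * Re z))"
  have "cmod (exp (s *\<^sub>R z) - exp (t *\<^sub>R z)) \<le> M * cmod (s *\<^sub>R z - t *\<^sub>R z)"
  proof (rule field_differentiable_bound[where f' = exp])
    show "convex (closed_segment (s *\<^sub>R z) (t *\<^sub>R z))" by simp
    show "(exp has_field_derivative exp u) (at u within closed_segment (s *\<^sub>R z) (t *\<^sub>R z))" for u
      by (rule DERIV_subset[OF DERIV_exp]) simp
    fix u assume "u \<in> closed_segment (s *\<^sub>R z) (t *\<^sub>R z)"
    then obtain r where r: "0 \<le> r" "r \<le> 1" "u = (1 - r) *\<^sub>R s *\<^sub>R z + r *\<^sub>R t *\<^sub>R z"
      by (auto simp: in_segment)
    then have "Re u = (1 - r) * (s * Re z) + r * (t * Re z)" by simp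
    also have "\<dots> \<le> max (s * Re z) (t * Re z)"
      using r by (intro convex_bound_le) auto
    finally show "cmod (exp u) \<le> M" 
      unfolding M_def norm_exp_eq_Re by (simp add: le_max_iff_disj)
  qed auto
  also have "\<dots> = \<bar>s - t\<bar> * (cmod z * M)"
    by (simp add: scaleR_diff_left[symmetric] del: scaleR_diff_left)
  finally have "cmod (exp (s *\<^sub>R z) - exp (t *\<^sub>R z)) / \<bar>s - t\<bar> \<le> cmod z * M"
    using assms by (simp add: pos_divide_le_eq mult.commute)
  moreover have "cmod (w /\<^sub>R r) = cmod w / \<bar>r\<bar>" for w r
    by (simp add: divide_inverse mult.commute)
  ultimately show ?thesis
    by (simp only: M_def)
qed

section \<open>The operator on the ranges of spectral projections\<close>

text \<open>
  With the spectrum of \<open>A\<close> for \<open>\<sigma>\<close> these are the scalar type spectral operators; the arguments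
  use of \<open>\<sigma>\<close> only that it is a closed set carrying \<open>E\<close>.
\<close>

locale spectral_operator = resolution_of_identity E
  for E :: "complex set \<Rightarrow> 'a::complex_banach \<Rightarrow> 'a" +
  fixes A :: "'a \<rightharpoonup> 'a" and \<sigma> :: "complex set"
  assumes closed_support: "closed \<sigma>" and E_support: "E \<sigma> = id"
    and A_eq: "A = spectral_integral E \<sigma> (\<lambda>z. z)"
begin

text \<open>
  The truncation sets in the definition of the integral of \<open>z\<close>.
\<close>

definition "core n = {z\<in>\<sigma>. cmod z \<le> real n}"

lemma borel_support [measurable, simp]: "\<sigma> \<in> sets borel"
  using closed_support by simp

lemma borel_core [measurable, simp]: "core n \<in> sets borel"
  unfolding core_def by measurable

lemma core_subset: "core n \<subseteq> \<sigma>"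
  by (auto simp: core_def)

lemma core_mono: "n \<le> k \<Longrightarrow> core n \<subseteq> core k"
  by (auto simp: core_def)

lemma E_core_tendsto: "(\<lambda>n. E (core n) f) \<longlonglongrightarrow> f"
proof -
  have "(\<lambda>n. E (\<sigma> - core n) f) \<longlonglongrightarrow> 0"
  proof (rule E_decseq)
    show "decseq (\<lambda>n. \<sigma> - core n)"
      by (auto simp: decseq_def core_def)
    show "(\<Inter>n. \<sigma> - core n) = {}"
      using real_arch_simple by (auto simp: core_def)
  qed auto
  moreover have "E (core n) f = f - E (\<sigma> - core n) f" for n
  proof -
    have "core n \<union> (\<sigma> - core n) = \<sigma>" using core_subset by blast
    then show ?thesis
      using E_Un[of "core n" "\<sigma> - core n" f] E_support by (simp add: eq_diff_eq)
  qed
  ultimately show ?thesis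
    using tendsto_diff[OF tendsto_const, of _ 0 sequentially f] by simp
qed

lemma eq_on_cores: "(\<And>n. E (core n) f = E (core n) g) \<Longrightarrow> f = g"
  using E_core_tendsto[of f] E_core_tendsto[of g] LIMSEQ_unique by auto

lemma bounded_borel_on_ident: "bounded_borel_on (core n) (\<lambda>z. z)"
  by (auto simp: bounded_borel_on_def core_def)

lemma bounded_borel_on_power: "bounded_borel_on (core n) (\<lambda>z. z ^ k)"
  by (induction k) (auto intro: bounded_borel_on_mult bounded_borel_on_ident bounded_borel_on_const)

lemma bounded_borel_on_exp: "bounded_borel_on (core n) (\<lambda>z. exp (t *\<^sub>R z))"
proof -
  have "cmod (exp (t *\<^sub>R z)) \<le> exp (\<bar>t\<bar> * real n)" if "z \<in> core n" for z
  proof -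
    have "t * Re z \<le> \<bar>t\<bar> * \<bar>Re z\<bar>" by (simp flip: abs_mult)
    also have "\<dots> \<le> \<bar>t\<bar> * n"
      using that abs_Re_le_cmod[of z] by (intro mult_left_mono) (auto simp: core_def)
    finally show ?thesis by simp
  qed
  then show ?thesis by (auto simp: bounded_borel_on_def)
qed

lemma A_Some_iff_tendsto: "A f = Some y \<longleftrightarrow> (\<lambda>n. integral_on (core n) (\<lambda>z. z) f) \<longlonglongrightarrow> y"
proof -
  have "truncation \<sigma> (\<lambda>z. z) n = (\<lambda>z. indicator (core n) z * z)" for n
    by (simp add: truncation_def core_def fun_eq_iff)
  then have "A f = (if convergent (\<lambda>n. integral_on (core n) (\<lambda>z. z) f) 
      then Some (lim (\<lambda>n. integral_on (core n) (\<lambda>z. z) f)) else None)"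
    by (simp add: A_eq spectral_integral_def integral_on_def Let_def)
  then show ?thesis
    using convergent_LIMSEQ_iff convergentI limI by (metis option.distinct(1) option.inject)
qed

text \<open>
  The working description of the graph of \<open>A\<close>: an equation between bounded operators on
  each part of the spectrum instead of a limit.
\<close>

lemma A_Some_iff: "A f = Some y \<longleftrightarrow> (\<forall>n. E (core n) y = integral_on (core n) (\<lambda>z. z) f)"
proof
  assume "A f = Some y"
  then have lim: "(\<lambda>k. integral_on (core k) (\<lambda>z. z) f) \<longlonglongrightarrow> y"
    by (simp add: A_Some_iff_tendsto)
  show "\<forall>n. E (core n) y = integral_on (core n) (\<lambda>z. z) f"
  proof
    fix n
    have "(\<lambda>k. E (core n) (integral_on (core k) (\<lambda>z. z) f)) \<longlonglongrightarrow> E (core n) y"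
      by (intro bounded_linear.tendsto[OF _ lim] bounded_clinear_bounded_linear bounded_clinear_E) simp
    moreover have "eventually (\<lambda>k. E (core n) (integral_on (core k) (\<lambda>z. z) f) = integral_on (core n) (\<lambda>z. z) f) sequentially"
      unfolding eventually_sequentially
      using core_mono by (auto simp: integral_on_E bounded_borel_on_ident Int_absorb1 intro!: exI[of _ n])
    ultimately have "(\<lambda>k. integral_on (core n) (\<lambda>z. z) f) \<longlonglongrightarrow> E (core n) y"
      by (rule Lim_transform_eventually)
    then show "E (core n) y = integral_on (core n) (\<lambda>z. z) f"
      by (simp add: LIMSEQ_const_iff)
  qed
next
  assume "\<forall>n. E (core n) y = integral_on (core n) (\<lambda>z. z) f"
  then show "A f = Some y"
    using E_core_tendsto[of y] by (simp add: A_Some_iff_tendsto)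
qed

section \<open>The spectrum as the support of the spectral measure\<close>

text \<open>
  If a disc around \<open>\<mu>\<close> is null, then \<open>1 / (\<mu> - z)\<close> is bounded on the rest of \<open>\<sigma>\<close>, and
  its integral is the resolvent. Both resolvent identities are checked after projecting to the parts
  of \<open>\<sigma>\<close> in discs, where they are identities between functions.
\<close>

lemma null_ball_resolvent:
  assumes "\<epsilon> > 0" and null: "\<And>f. E (ball \<mu> \<epsilon>) f = 0"
  shows "\<mu> \<in> resolvent_set A"
proof -
  define D where "D = \<sigma> - ball \<mu> \<epsilon>"
  have D[measurable, simp]: "D \<in> sets borel" unfolding D_def by simp
  have far: "cmod (\<mu> - z) \<ge> \<epsilon>" if "z \<in> D" for z
    using that by (auto simp: D_def dist_norm)
  have r: "bounded_borel_on D (\<lambda>z. 1 / (\<mu> - z))"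
  proof -
    have "cmod (1 / (\<mu> - z)) \<le> 1 / \<epsilon>" if "z \<in> D" for z
      unfolding norm_divide norm_one using far[OF that] \<open>\<epsilon> > 0\<close> by (intro frac_le) auto
    moreover have "(\<lambda>z. 1 / (\<mu> - z)) \<in> borel_measurable borel" by measurable
    ultimately show ?thesis unfolding bounded_borel_on_def by auto
  qed
  define R where "R = integral_on D (\<lambda>z. 1 / (\<mu> - z))"
  define Dn where "Dn n = core n \<inter> D" for n
  have Dn[measurable, simp]: "Dn n \<in> sets borel" for n unfolding Dn_def by simp
  have rn: "bounded_borel_on (Dn n) (\<lambda>z. 1 / (\<mu> - z))" for n
    by (rule bounded_borel_on_subset[OF r]) (auto simp: Dn_def)
  have Dn_core: "Dn n \<inter> core n = Dn n" for n by (auto simp: Dn_def)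
  have E_Dn: "E (core n) f = E (Dn n) f" for n f
  proof -
    have "core n = Dn n \<union> (core n \<inter> ball \<mu> \<epsilon>)" "Dn n \<inter> (core n \<inter> ball \<mu> \<epsilon>) = {}"
      using core_subset by (auto simp: Dn_def D_def)
    then have "E (core n) f = E (Dn n) f + E (core n \<inter> ball \<mu> \<epsilon>) f"
      using E_Un[of "Dn n" "core n \<inter> ball \<mu> \<epsilon>" f] by auto
    moreover have "E (core n \<inter> ball \<mu> \<epsilon>) f = 0"
      by (simp add: E_Int null bounded_clinear_zero bounded_clinear_E)
    ultimately show ?thesis by simp
  qed
  have R_core: "E (core n) (R y) = integral_on (Dn n) (\<lambda>z. 1 / (\<mu> - z)) y" for n y
    unfolding R_def by (simp add: integral_on_E r Dn_def Int_commute)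
  \<comment> \<open>\<open>z / (\<mu> - z) = \<mu> / (\<mu> - z) - 1\<close> away from \<open>\<mu>\<close>\<close>
  have range: "A (R y) = Some (\<mu> *\<^sub>C R y - y)" for y
    unfolding A_Some_iff
  proof
    fix n
    have "integral_on (core n) (\<lambda>z. z) (R y) = integral_on (Dn n) (\<lambda>z. z * (1 / (\<mu> - z))) y"
      unfolding R_def Dn_def by (rule integral_on_mult[OF bounded_borel_on_ident r])
    also have "integral_on (Dn n) (\<lambda>z. z * (1 / (\<mu> - z))) = integral_on (Dn n) (\<lambda>z. \<mu> * (1 / (\<mu> - z)) - 1)"
    proof (rule integral_on_cong)
      fix z assume "z \<in> Dn n"
      then have "\<mu> - z \<noteq> 0" using far[of z] \<open>\<epsilon> > 0\<close> by (auto simp: Dn_def)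
      then show "z * (1 / (\<mu> - z)) = \<mu> * (1 / (\<mu> - z)) - 1"
        by (simp add: field_simps)
    qed
    also have "\<dots> y = \<mu> *\<^sub>C integral_on (Dn n) (\<lambda>z. 1 / (\<mu> - z)) y - E (Dn n) y"
      using bounded_borel_on_mult[OF bounded_borel_on_const rn]
      by (simp add: integral_on_diff bounded_borel_on_const rn integral_on_one integral_on_scaleC[OF rn] del: times_divide_eq_right)
    also have "\<dots> = E (core n) (\<mu> *\<^sub>C R y - y)"
      by (simp add: bounded_clinear_diff[OF bounded_clinear_E] bounded_clinear_scaleC[OF bounded_clinear_E] R_core E_Dn[of n y])
    finally show "E (core n) (\<mu> *\<^sub>C R y - y) = integral_on (core n) (\<lambda>z. z) (R y)" by simp
  qed
  have left: "R (\<mu> *\<^sub>C x - y) = x" if "A x = Some y" for x y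
  proof (rule eq_on_cores)
    fix n
    have "E (core n) (R (\<mu> *\<^sub>C x - y)) = integral_on (Dn n) (\<lambda>z. 1 / (\<mu> - z)) (E (core n) (\<mu> *\<^sub>C x - y))"
      using integral_on_E(1)[OF rn, of "core n" n] by (simp add: R_core Dn_core)
    also have "E (core n) (\<mu> *\<^sub>C x - y) = \<mu> *\<^sub>C E (core n) x - integral_on (core n) (\<lambda>z. z) x"
      using that by (simp add: A_Some_iff bounded_clinear_diff[OF bounded_clinear_E] bounded_clinear_scaleC[OF bounded_clinear_E])
    also have "\<dots> = integral_on (core n) (\<lambda>z. \<mu> - z) x"
      using integral_on_scaleC[OF bounded_borel_on_const[of "core n" 1], of \<mu> x]
      by (simp add: integral_on_diff bounded_borel_on_const bounded_borel_on_ident integral_on_one)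
    also have "integral_on (Dn n) (\<lambda>z. 1 / (\<mu> - z)) \<dots> = integral_on (Dn n) (\<lambda>z. 1 / (\<mu> - z) * (\<mu> - z)) x"
    proof -
      have "bounded_borel_on (core n) (\<lambda>z. \<mu> + -1 * z)"
        by (intro bounded_borel_on_add bounded_borel_on_mult bounded_borel_on_ident bounded_borel_on_const) simp_all
      then show ?thesis
        using integral_on_mult[OF rn, of "core n" "\<lambda>z. \<mu> - z" n x] by (simp add: Dn_core)
    qed
    also have "integral_on (Dn n) (\<lambda>z. 1 / (\<mu> - z) * (\<mu> - z)) = integral_on (Dn n) (\<lambda>_. 1)"
      using far \<open>\<epsilon> > 0\<close> by (intro integral_on_cong) (force simp: Dn_def)
    finally show "E (core n) (R (\<mu> *\<^sub>C x - y)) = E (core n) x"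
      by (simp add: integral_on_one E_Dn)
  qed
  have "bounded_clinear R"
    unfolding R_def by (rule integral_on_bounded_clinear[OF r])
  then show ?thesis
    unfolding resolvent_set_def using range left by (auto intro!: exI[of _ R])
qed

text \<open>
  Near \<open>\<mu>\<close> the operator acts on a nonzero range of \<open>E\<close> almost as multiplication by \<open>F \<mu>\<close>.
\<close>

lemma spectral_value_le:
  assumes \<mu>: "\<mu> \<in> spectrum A" and ok: "\<And>n. bounded_borel_on (core n) F" and cont: "isCont F \<mu>"
    and bound: "\<And>n g. norm (integral_on (core n) F g) \<le> B * norm g"
  shows "cmod (F \<mu>) \<le> B"
proof -
  have le: "cmod (F \<mu>) \<le> B + calculus_bound * e" if "e > 0" for e
  proof -
    obtain \<delta> where "\<delta> > 0" and \<delta>: "\<And>z. dist z \<mu> < \<delta> \<Longrightarrow> dist (F z) (F \<mu>) < e"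
      using cont \<open>e > 0\<close> unfolding continuous_at_eps_delta by blast
    have "\<exists>f. E (ball \<mu> \<delta>) f \<noteq> 0"
      using null_ball_resolvent[OF \<open>\<delta> > 0\<close>] \<mu> by (auto simp: spectrum_def)
    then obtain f where f: "E (ball \<mu> \<delta>) f \<noteq> 0" by blast
    define D where "D = \<sigma> \<inter> ball \<mu> \<delta>"
    have [measurable, simp]: "D \<in> sets borel" by (simp add: D_def)
    define g where "g = E (ball \<mu> \<delta>) f"
    have "g \<noteq> 0" using f by (simp add: g_def)
    have "E D g = E \<sigma> (E (ball \<mu> \<delta>) g)"
      by (simp add: D_def E_Int)
    also have "\<dots> = g"
      by (simp add: E_support g_def flip: E_Int)
    finally have g: "E D g = g" .
    obtain n :: nat where n: "cmod \<mu> + \<delta> \<le> n" using real_arch_simple by blast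
    have "D \<subseteq> core n"
    proof
      fix z assume "z \<in> D"
      then show "z \<in> core n"
        using n norm_triangle_ineq2[of z \<mu>] by (auto simp: D_def core_def dist_norm norm_minus_commute)
    qed
    then have okD: "bounded_borel_on D F"
      by (intro bounded_borel_on_subset[OF ok]) auto
    have okd: "bounded_borel_on D (\<lambda>z. F z - F \<mu>)"
      using bounded_borel_on_add[OF okD bounded_borel_on_const[of D "- F \<mu>"]] by simp
    have "integral_on (core n) F g = integral_on D F g"
      using integral_on_E(1)[OF ok, of D n g] \<open>D \<subseteq> core n\<close> by (simp add: g Int_absorb1)
    also have "\<dots> = integral_on D (\<lambda>z. F z - F \<mu>) g + F \<mu> *\<^sub>C g"
      using integral_on_add[OF okd bounded_borel_on_const[of D "F \<mu>"], of g] 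
        integral_on_scaleC[OF bounded_borel_on_const[of D 1], of "F \<mu>" g]
      by (simp add: integral_on_one g)
    finally have "cmod (F \<mu>) * norm g = norm (integral_on (core n) F g - integral_on D (\<lambda>z. F z - F \<mu>) g)"
      by (simp add: norm_scaleC)
    also have "\<dots> \<le> B * norm g + calculus_bound * e * norm g"
    proof (rule order_trans[OF norm_triangle_ineq4], intro add_mono bound integral_on_norm_le)
      show "cmod (F z - F \<mu>) \<le> e" if "z \<in> D" for z
        using \<delta>[of z] that by (auto simp: D_def dist_norm norm_minus_commute)
    qed (use okd \<open>e > 0\<close> in \<open>auto simp: bounded_borel_on_def\<close>)
    also have "\<dots> = (B + calculus_bound * e) * norm g" by (simp add: algebra_simps)
    finally show ?thesis using \<open>g \<noteq> 0\<close> by simp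
  qed
  have "((\<lambda>e. B + calculus_bound * e) \<longlongrightarrow> B + calculus_bound * 0) (at_right 0)"
    by (intro tendsto_intros)
  then have "cmod (F \<mu>) \<le> B + calculus_bound * 0"
    using le by (intro tendsto_lowerbound[of _ _ "at_right (0::real)"]) (auto simp: eventually_at_filter)
  then show ?thesis by simp
qed

section \<open>Differentiation under the spectral integral\<close>

text \<open>
  Differentiation under the integral; \<open>B\<close> dominates the difference quotients by
  \<open>norm_exp_quotient_le\<close>.
\<close>

lemma has_vector_derivative_exp_integral:
  assumes D: "D \<in> sets borel" and F[measurable]: "F \<in> borel_measurable borel" and X: "open X" "t \<in> X"
    and ok: "\<And>s. s \<in> X \<Longrightarrow> bounded_borel_on D (\<lambda>z. F z * exp (s *\<^sub>R z))"
    and B: "\<And>s z. s \<in> X \<Longrightarrow> z \<in> D \<Longrightarrow> cmod (F z) * cmod z * exp (s * Re z) \<le> B"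
  shows "((\<lambda>s. integral_on D (\<lambda>z. F z * exp (s *\<^sub>R z)) f) has_vector_derivative 
     integral_on D (\<lambda>z. F z * z * exp (t *\<^sub>R z)) f) (at t)"
  unfolding has_vector_derivative_iff_quotient
proof (rule Lim_transform_within_open[OF _ X])
  show "((\<lambda>s. integral_on D (\<lambda>z. F z * ((exp (s *\<^sub>R z) - exp (t *\<^sub>R z)) /\<^sub>R (s - t))) f) \<longlongrightarrow> 
      integral_on D (\<lambda>z. F z * z * exp (t *\<^sub>R z)) f) (at t)"
  proof (rule dominated_convergence_at[OF D _ _ _ _ tendsto_const])
    show "\<forall>\<^sub>F s in at t. \<forall>z\<in>D. cmod (F z * ((exp (s *\<^sub>R z) - exp (t *\<^sub>R z)) /\<^sub>R (s - t))) \<le> B"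
      unfolding eventually_at_topological
    proof (intro exI[of _ X] conjI ballI impI X)
      fix s z assume s: "s \<in> X" "s \<noteq> t" and z: "z \<in> D"
      have "cmod (F z * ((exp (s *\<^sub>R z) - exp (t *\<^sub>R z)) /\<^sub>R (s - t))) 
          \<le> cmod (F z) * (cmod z * max (exp (s * Re z)) (exp (t * Re z)))"
        unfolding norm_mult by (intro mult_left_mono norm_exp_quotient_le s) simp
      also have "\<dots> \<le> B"
        using B[OF s(1) z] B[OF X(2) z] by (simp add: max_def mult.assoc)
      finally show "cmod (F z * ((exp (s *\<^sub>R z) - exp (t *\<^sub>R z)) /\<^sub>R (s - t))) \<le> B" .
    qed
    fix z :: complex
    have "((\<lambda>s. (exp (s *\<^sub>R z) - exp (t *\<^sub>R z)) /\<^sub>R (s - t)) \<longlongrightarrow> exp (t *\<^sub>R z) * z) (at t)"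
      using exp_scaleR_has_vector_derivative_right[of z t UNIV] unfolding has_vector_derivative_iff_quotient by simp
    from tendsto_mult_left[OF this, of "F z"]
    show "((\<lambda>s. F z * ((exp (s *\<^sub>R z) - exp (t *\<^sub>R z)) /\<^sub>R (s - t))) \<longlongrightarrow> F z * z * exp (t *\<^sub>R z)) (at t)"
      by (simp add: mult_ac)
  qed measurable
  fix s assume s: "s \<in> X" "s \<noteq> t"
  have d: "bounded_borel_on D (\<lambda>z. F z * exp (s *\<^sub>R z) - F z * exp (t *\<^sub>R z))"
    using bounded_borel_on_add[OF ok[OF s(1)] bounded_borel_on_mult[OF bounded_borel_on_const[OF D, of "-1"] ok[OF X(2)]]]
    by simp
  have "(\<lambda>z. F z * ((exp (s *\<^sub>R z) - exp (t *\<^sub>R z)) /\<^sub>R (s - t))) = 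
     (\<lambda>z. of_real (inverse (s - t)) * (F z * exp (s *\<^sub>R z) - F z * exp (t *\<^sub>R z)))"
    by (simp add: scaleR_conv_of_real algebra_simps)
  then show "integral_on D (\<lambda>z. F z * ((exp (s *\<^sub>R z) - exp (t *\<^sub>R z)) /\<^sub>R (s - t))) f = 
      (integral_on D (\<lambda>z. F z * exp (s *\<^sub>R z)) f - integral_on D (\<lambda>z. F z * exp (t *\<^sub>R z)) f) /\<^sub>R (s - t)"
    by (simp add: integral_on_scaleC[OF d] integral_on_diff[OF ok[OF s(1)] ok[OF X(2)]] scaleC_of_real del: of_real_inverse of_real_diff)
qed

lemma has_vector_derivative_core:
  "((\<lambda>s. integral_on (core n) (\<lambda>z. z ^ k * exp (s *\<^sub>R z)) f) has_vector_derivative 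
     integral_on (core n) (\<lambda>z. z ^ Suc k * exp (t *\<^sub>R z)) f) (at t)"
proof -
  have "cmod (z ^ k) * cmod z * exp (s * Re z) \<le> real n ^ k * real n * exp ((\<bar>t\<bar> + 1) * n)" 
    if "s \<in> ball t 1" "z \<in> core n" for s z
  proof -
    have "s * Re z \<le> \<bar>s\<bar> * \<bar>Re z\<bar>" by (simp flip: abs_mult)
    also have "\<dots> \<le> (\<bar>t\<bar> + 1) * n"
      using that abs_Re_le_cmod[of z] by (intro mult_mono) (auto simp: core_def dist_real_def)
    finally have "exp (s * Re z) \<le> exp ((\<bar>t\<bar> + 1) * n)" by simp
    then show ?thesis
      using that unfolding norm_power by (intro mult_mono power_mono) (auto simp: core_def)
  qed
  moreover have "bounded_borel_on (core n) (\<lambda>z. z ^ k * exp (s *\<^sub>R z))" for s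
    by (intro bounded_borel_on_mult bounded_borel_on_power bounded_borel_on_exp)
  ultimately have "((\<lambda>s. integral_on (core n) (\<lambda>z. z ^ k * exp (s *\<^sub>R z)) f) has_vector_derivative 
     integral_on (core n) (\<lambda>z. z ^ k * z * exp (t *\<^sub>R z)) f) (at t)"
    by (intro has_vector_derivative_exp_integral[where X = "ball t 1"]) simp_all
  then show ?thesis
    by (simp only: power_Suc2)
qed

section \<open>The exponential semigroup\<close>

abbreviation exp_family :: "real \<Rightarrow> 'a \<Rightarrow> 'a" where
  "exp_family t \<equiv> integral_on \<sigma> (\<lambda>z. exp (t *\<^sub>R z))"

context
  fixes w :: real
  assumes half_plane: "\<And>z. z \<in> \<sigma> \<Longrightarrow> Re z \<le> w" and w_nonneg: "0 \<le> w"
begin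

lemma exp_le: "0 \<le> t \<Longrightarrow> t \<le> r \<Longrightarrow> z \<in> \<sigma> \<Longrightarrow> exp (t * Re z) \<le> exp (r * w)"
proof -
  assume "0 \<le> t" "t \<le> r" "z \<in> \<sigma>"
  then have "t * Re z \<le> t * w" "t * w \<le> r * w"
    using half_plane w_nonneg by (auto intro: mult_left_mono mult_right_mono)
  then show ?thesis by simp
qed

lemma bounded_borel_on_exp_support: "0 \<le> t \<Longrightarrow> bounded_borel_on \<sigma> (\<lambda>z. exp (t *\<^sub>R z))"
  unfolding bounded_borel_on_def using exp_le[of t t] by auto

lemma C0_semigroup_exp: "C0_semigroup exp_family"
  unfolding C0_semigroup_def
proof (intro conjI allI impI)
  show "bounded_clinear (exp_family t)" if "0 \<le> t" for t
    by (intro integral_on_bounded_clinear bounded_borel_on_exp_support that)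
  show "exp_family 0 = id"
    by (simp add: integral_on_one E_support fun_eq_iff)
  show "exp_family (t + s) = exp_family t \<circ> exp_family s" if "0 \<le> t" "0 \<le> s" for t s
    using integral_on_mult[OF bounded_borel_on_exp_support bounded_borel_on_exp_support] that
    by (simp add: fun_eq_iff scaleR_add_left exp_add)
  show "continuous_on {0..} (\<lambda>t. exp_family t f)" for f
    unfolding continuous_on_def
  proof
    fix t :: real assume "t \<in> {0..}"
    show "((\<lambda>t. exp_family t f) \<longlongrightarrow> exp_family t f) (at t within {0..})"
    proof (rule dominated_convergence_at[OF _ _ _ _ _ tendsto_const])
      have "eventually (\<lambda>s. s \<in> {0..} \<and> s < t + 1) (at t within {0..})"
        by (auto simp: eventually_at_topological intro!: exI[of _ "{..<t+1}"])
      then show "\<forall>\<^sub>F s in at t within {0..}. \<forall>z\<in>\<sigma>. cmod (exp (s *\<^sub>R z)) \<le> exp ((t + 1) * w)"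
        by (rule eventually_mono) (use exp_le in \<open>auto simp del: exp_le_cancel_iff\<close>)
    qed (auto intro!: tendsto_intros)
  qed
qed

lemma E_core_quotient:
  assumes "0 < t"
  shows "E (core n) ((exp_family t f - f) /\<^sub>R t) = integral_on (core n) (\<lambda>z. (exp (t *\<^sub>R z) - 1) /\<^sub>R t) f"
proof -
  have eq: "E (core n) (exp_family t f - f) = integral_on (core n) (\<lambda>z. exp (t *\<^sub>R z) - 1) f"
    using assms core_subset[of n]
    by (simp add: E_diff integral_on_E bounded_borel_on_exp_support Int_absorb1
        integral_on_diff bounded_borel_on_exp bounded_borel_on_const integral_on_one)
  have "bounded_borel_on (core n) (\<lambda>z. exp (t *\<^sub>R z) + (-1))"
    by (intro bounded_borel_on_add bounded_borel_on_exp bounded_borel_on_const) simp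
  then have ok: "bounded_borel_on (core n) (\<lambda>z. exp (t *\<^sub>R z) - 1)" by simp
  have "(\<lambda>z. (exp (t *\<^sub>R z) - 1) /\<^sub>R t) = (\<lambda>z. complex_of_real (inverse t) * (exp (t *\<^sub>R z) - 1))"
    by (simp only: scaleR_conv_of_real)
  then show ?thesis
    by (simp only: E_scaleR[OF borel_core] eq integral_on_scaleC[OF ok] scaleC_of_real)
qed

lemma quotient_tendsto: "((\<lambda>t. (exp (t *\<^sub>R z) - 1) /\<^sub>R t) \<longlongrightarrow> z) (at_right (0::real))" for z :: complex
  using exp_scaleR_has_vector_derivative_right[of z 0 "{0<..}"] 
  unfolding has_vector_derivative_iff_quotient by simp

lemma norm_quotient_le:
  assumes "0 < t" "t < 1" "z \<in> \<sigma>"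
  shows "cmod ((exp (t *\<^sub>R z) - 1) /\<^sub>R t) \<le> cmod z * exp w"
proof -
  have "cmod ((exp (t *\<^sub>R z) - 1) /\<^sub>R t) \<le> cmod z * max (exp (t * Re z)) 1"
    using norm_exp_quotient_le[of t 0 z] assms by simp
  also have "\<dots> \<le> cmod z * exp w"
    using exp_le[of t 1 z] assms w_nonneg by (intro mult_left_mono) auto
  finally show ?thesis .
qed

text \<open>
  After projection the difference quotients converge to the integral of \<open>z\<close> by
  dominated convergence, since \<open>z\<close> is bounded there.
\<close>

lemma generator_quotient_imp_A:
  assumes "((\<lambda>t. (exp_family t f - f) /\<^sub>R t) \<longlongrightarrow> y) (at_right 0)"
  shows "A f = Some y"
  unfolding A_Some_iff
proof
  fix n
  have "((\<lambda>t. E (core n) ((exp_family t f - f) /\<^sub>R t)) \<longlongrightarrow> E (core n) y) (at_right 0)"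
    by (intro bounded_linear.tendsto[OF _ assms] bounded_clinear_bounded_linear bounded_clinear_E) simp
  moreover have "eventually (\<lambda>t. E (core n) ((exp_family t f - f) /\<^sub>R t) = 
      integral_on (core n) (\<lambda>z. (exp (t *\<^sub>R z) - 1) /\<^sub>R t) f) (at_right 0)"
    using E_core_quotient by (auto simp: eventually_at_filter)
  ultimately have 1: "((\<lambda>t. integral_on (core n) (\<lambda>z. (exp (t *\<^sub>R z) - 1) /\<^sub>R t) f) \<longlongrightarrow> E (core n) y) (at_right 0)"
    by (rule Lim_transform_eventually)
  have 2: "((\<lambda>t. integral_on (core n) (\<lambda>z. (exp (t *\<^sub>R z) - 1) /\<^sub>R t) f) \<longlongrightarrow> integral_on (core n) (\<lambda>z. z) f) (at_right 0)"
  proof (rule dominated_convergence_at[OF _ _ _ _ _ tendsto_const])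
    have "eventually (\<lambda>t::real. 0 < t \<and> t < 1) (at_right 0)"
      by (auto simp: eventually_at_right_field intro!: exI[of _ 1])
    then show "\<forall>\<^sub>F t in at_right 0. \<forall>z\<in>core n. cmod ((exp (t *\<^sub>R z) - 1) /\<^sub>R t) \<le> real n * exp w"
    proof (rule eventually_mono, intro ballI)
      fix t z assume t: "0 < t \<and> t < (1::real)" and z: "z \<in> core n"
      then have "cmod ((exp (t *\<^sub>R z) - 1) /\<^sub>R t) \<le> cmod z * exp w"
        using core_subset by (intro norm_quotient_le) auto
      also have "\<dots> \<le> real n * exp w"
        using z by (auto simp: core_def)
      finally show "cmod ((exp (t *\<^sub>R z) - 1) /\<^sub>R t) \<le> real n * exp w" .
    qed
  qed (auto intro: quotient_tendsto)
  show "E (core n) y = integral_on (core n) (\<lambda>z. z) f"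
    using tendsto_unique[OF _ 1 2] by simp
qed

text \<open>
  On the whole of \<open>\<sigma>\<close> the difference quotients of \<open>exp (t z)\<close> are not uniformly bounded. Dividing
  by \<open>z\<close> gives a uniformly bounded family \<open>\<psi> t\<close> that tends to \<open>1\<close>, and the difference quotient at \<open>f\<close>
  is the integral of \<open>\<psi> t\<close> applied to \<open>y = A f\<close>.
\<close>

lemma A_imp_generator_quotient:
  assumes "A f = Some y"
  shows "((\<lambda>t. (exp_family t f - f) /\<^sub>R t) \<longlongrightarrow> y) (at_right 0)"
proof -
  \<comment> \<open>the value at \<open>z = 0\<close> is the limit of the quotient there\<close>
  define \<psi> where "\<psi> t z = (if z = 0 then 1 else (exp (t *\<^sub>R z) - 1) /\<^sub>R t / z)" for t :: real and z :: complex
  have [measurable]: "\<psi> t \<in> borel_measurable borel" for t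
    unfolding \<psi>_def by measurable
  have \<psi>_le: "cmod (\<psi> t z) \<le> exp w" if "0 < t" "t < 1" "z \<in> \<sigma>" for t z
  proof (cases "z = 0")
    case True
    then show ?thesis using w_nonneg by (simp add: \<psi>_def)
  next
    case False
    then show ?thesis
      using norm_quotient_le[OF that] unfolding \<psi>_def by (simp add: norm_divide pos_divide_le_eq mult.commute del: norm_scaleR)
  qed
  have ev: "eventually (\<lambda>t::real. 0 < t \<and> t < 1) (at_right 0)"
    by (auto simp: eventually_at_right_field intro!: exI[of _ 1])
  have "((\<lambda>t. integral_on \<sigma> (\<psi> t) y) \<longlongrightarrow> integral_on \<sigma> (\<lambda>_. 1) y) (at_right 0)"
  proof (rule dominated_convergence_at[OF _ _ _ _ _ tendsto_const])
    show "\<forall>\<^sub>F t in at_right 0. \<forall>z\<in>\<sigma>. cmod (\<psi> t z) \<le> exp w"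
      using ev by (rule eventually_mono) (use \<psi>_le in auto)
    show "((\<lambda>t. \<psi> t z) \<longlongrightarrow> 1) (at_right 0)" for z
      using tendsto_divide[OF quotient_tendsto[of z] tendsto_const, of z] by (cases "z = 0") (auto simp: \<psi>_def)
  qed auto
  moreover have "integral_on \<sigma> (\<psi> t) y = (exp_family t f - f) /\<^sub>R t" if t: "0 < t" "t < 1" for t
  proof (rule eq_on_cores)
    fix n
    have ok: "bounded_borel_on \<sigma> (\<psi> t)"
      using \<psi>_le[OF t] by (auto simp: bounded_borel_on_def)
    have okn: "bounded_borel_on (core n) (\<psi> t)"
      by (rule bounded_borel_on_subset[OF ok core_subset borel_core])
    have "E (core n) (integral_on \<sigma> (\<psi> t) y) = integral_on (core n) (\<psi> t) (E (core n) y)"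
      using core_subset[of n] by (simp add: integral_on_E ok okn Int_absorb1)
    also have "E (core n) y = integral_on (core n) (\<lambda>z. z) f"
      using assms by (simp add: A_Some_iff)
    also have "integral_on (core n) (\<psi> t) \<dots> = integral_on (core n) (\<lambda>z. \<psi> t z * z) f"
      by (simp add: integral_on_mult okn bounded_borel_on_ident)
    also have "(\<lambda>z. \<psi> t z * z) = (\<lambda>z. (exp (t *\<^sub>R z) - 1) /\<^sub>R t)"
    proof
      fix z
      have "q / z * z = q" if "z \<noteq> 0" for q :: complex
        using that by simp
      then show "\<psi> t z * z = (exp (t *\<^sub>R z) - 1) /\<^sub>R t"
        by (cases "z = 0") (simp_all add: \<psi>_def del: times_divide_eq_left)
    qed
    finally show "E (core n) (integral_on \<sigma> (\<psi> t) y) = E (core n) ((exp_family t f - f) /\<^sub>R t)"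
      using t by (simp add: E_core_quotient)
  qed
  ultimately show ?thesis
    using ev by (simp add: integral_on_one E_support Lim_transform_eventually eventually_mono)
qed

lemma generator_exp: "generator exp_family = A"
proof
  fix f
  show "generator exp_family f = A f"
  proof (cases "\<exists>y. ((\<lambda>t. (exp_family t f - f) /\<^sub>R t) \<longlongrightarrow> y) (at_right 0)")
    case True
    then obtain y where y: "((\<lambda>t. (exp_family t f - f) /\<^sub>R t) \<longlongrightarrow> y) (at_right 0)" by blast
    then show ?thesis
      using True tendsto_Lim[OF _ y] generator_quotient_imp_A[OF y] by (auto simp: generator_def)
  next
    case False
    then have "A f = None"
      using A_imp_generator_quotient by (cases "A f") auto
    then show ?thesis
      using False by (simp add: generator_def)
  qed
qed

lemma exp_orbit_derivatives:
  assumes growth: "\<And>p q n. 0 < p \<Longrightarrow> p \<le> q \<Longrightarrow> 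
      \<exists>B. \<forall>t\<in>{p..q}. \<forall>z\<in>\<sigma>. cmod z ^ n * exp (t * Re z) \<le> B"
  shows "0 < t \<Longrightarrow> (nth_vector_derivative {0<..} (\<lambda>t. exp_family t f) n has_vector_derivative
        integral_on \<sigma> (\<lambda>z. z ^ Suc n * exp (t *\<^sub>R z)) f) (at t) \<and>
     nth_vector_derivative {0<..} (\<lambda>t. exp_family t f) n t = integral_on \<sigma> (\<lambda>z. z ^ n * exp (t *\<^sub>R z)) f"
proof (induction n arbitrary: t)
  have der: "((\<lambda>t. integral_on \<sigma> (\<lambda>z. z ^ n * exp (t *\<^sub>R z)) f) has_vector_derivative
      integral_on \<sigma> (\<lambda>z. z ^ Suc n * exp (t *\<^sub>R z)) f) (at t)" if "0 < t" for n t
  proof -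
    \<comment> \<open>a neighbourhood of \<open>t\<close> whose closure stays away from \<open>0\<close>, where the growth bound may fail\<close>
    define X where "X = {t / 2<..<2 * t}"
    have near: "\<exists>B. \<forall>s\<in>X. \<forall>z\<in>\<sigma>. cmod z ^ k * exp (s * Re z) \<le> B" for k
    proof -
      obtain B where "\<forall>s\<in>{t / 2..2 * t}. \<forall>z\<in>\<sigma>. cmod z ^ k * exp (s * Re z) \<le> B"
        using growth[of "t / 2" "2 * t" k] \<open>0 < t\<close> by auto
      then show ?thesis
        by (intro exI[of _ B]) (auto simp: X_def)
    qed
    obtain B where B: "\<And>s z. s \<in> X \<Longrightarrow> z \<in> \<sigma> \<Longrightarrow> cmod z ^ Suc n * exp (s * Re z) \<le> B"
      using near[of "Suc n"] by blast
    have "((\<lambda>t. integral_on \<sigma> (\<lambda>z. z ^ n * exp (t *\<^sub>R z)) f) has_vector_derivative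
      integral_on \<sigma> (\<lambda>z. z ^ n * z * exp (t *\<^sub>R z)) f) (at t)"
    proof (rule has_vector_derivative_exp_integral[where X = X and B = B])
      show "bounded_borel_on \<sigma> (\<lambda>z. z ^ n * exp (s *\<^sub>R z))" if "s \<in> X" for s
        using near[of n] that by (auto simp: bounded_borel_on_def norm_mult norm_power)
      show "cmod (z ^ n) * cmod z * exp (s * Re z) \<le> B" if "s \<in> X" "z \<in> \<sigma>" for s z
        using B[OF that] by (simp add: norm_power mult.commute)
    qed (use \<open>0 < t\<close> in \<open>auto simp: X_def\<close>)
    then show ?thesis
      by (simp only: power_Suc2)
  qed
  {
    case 0
    then show ?case using der[of t 0] by simp
  next
    case (Suc n)
    have val: "nth_vector_derivative {0<..} (\<lambda>t. exp_family t f) (Suc n) t = 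
      integral_on \<sigma> (\<lambda>z. z ^ Suc n * exp (t *\<^sub>R z)) f" if "0 < t" for t
      using Suc.IH[OF that] that by (simp add: at_within_open[of _ "{0<..}"] vector_derivative_at)
    have "(nth_vector_derivative {0<..} (\<lambda>t. exp_family t f) (Suc n) has_vector_derivative
        integral_on \<sigma> (\<lambda>z. z ^ Suc (Suc n) * exp (t *\<^sub>R z)) f) (at t)"
      by (rule has_vector_derivative_transform_within_open[OF der, where S = "{0<..}"])
        (use Suc.prems val in auto)
    with val[OF Suc.prems] show ?case by blast
  }
qed

theorem generates_carleman_semigroup_exp:
  assumes m: "\<And>n. 0 < m n"
    and growth: "\<And>p q \<alpha>. 0 < p \<Longrightarrow> p \<le> q \<Longrightarrow> 0 < \<alpha> \<Longrightarrow> 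
      \<exists>c>0. \<forall>n. \<forall>t\<in>{p..q}. \<forall>z\<in>\<sigma>. cmod z ^ n * exp (t * Re z) \<le> c * \<alpha> ^ n * m n"
  shows "generates_carleman_semigroup m A"
proof -
  have g: "\<exists>B. \<forall>t\<in>{p..q}. \<forall>z\<in>\<sigma>. cmod z ^ n * exp (t * Re z) \<le> B" if "0 < p" "p \<le> q" for p q n
    using growth[OF that, of 1] by auto
  note der = exp_orbit_derivatives[OF g]
  have "(\<lambda>t. exp_family t f) \<in> carleman_beurling m {0<..}" for f
    unfolding carleman_beurling_def mem_Collect_eq
  proof (intro conjI allI impI)
    show "nth_vector_derivative {0<..} (\<lambda>t. exp_family t f) n differentiable_on {0<..}" for n
      unfolding differentiable_on_def
    proof
      fix t :: real assume "t \<in> {0<..}"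
      then have "(nth_vector_derivative {0<..} (\<lambda>t. exp_family t f) n has_vector_derivative
          integral_on \<sigma> (\<lambda>z. z ^ Suc n * exp (t *\<^sub>R z)) f) (at t)"
        using der by blast
      then show "nth_vector_derivative {0<..} (\<lambda>t. exp_family t f) n differentiable at t within {0<..}"
        by (rule differentiable_at_withinI[OF differentiableI_vector])
    qed
    fix a b \<alpha> :: real assume ab: "a \<le> b" "{a..b} \<subseteq> {0<..}" and "0 < \<alpha>"
    then have "0 < a" by auto
    from growth[OF this ab(1) \<open>0 < \<alpha>\<close>] obtain c where "c > 0"
      and c: "\<And>n t z. t \<in> {a..b} \<Longrightarrow> z \<in> \<sigma> \<Longrightarrow> cmod z ^ n * exp (t * Re z) \<le> c * \<alpha> ^ n * m n"
      by blast
    have "norm (nth_vector_derivative {0<..} (\<lambda>t. exp_family t f) n t) \<le> (calculus_bound * c * norm f + 1) * \<alpha> ^ n * m n"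
      if t: "t \<in> {a..b}" for n t
    proof -
      have pos: "0 \<le> \<alpha> ^ n * m n"
        using \<open>0 < \<alpha>\<close> m[of n] by simp
      have "0 < t" using t \<open>0 < a\<close> by auto
      then have "nth_vector_derivative {0<..} (\<lambda>t. exp_family t f) n t = integral_on \<sigma> (\<lambda>z. z ^ n * exp (t *\<^sub>R z)) f"
        using der by blast
      also have "norm \<dots> \<le> calculus_bound * (c * \<alpha> ^ n * m n) * norm f"
        using c[OF t] \<open>0 < c\<close> pos by (intro integral_on_norm_le) (auto simp: norm_mult norm_power mult.assoc)
      also have "\<dots> \<le> (calculus_bound * c * norm f + 1) * \<alpha> ^ n * m n"
        using pos by (simp add: algebra_simps)
      finally show ?thesis .
    qed
    moreover have "calculus_bound * c * norm f + 1 > 0"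
      using calculus_bound_nonneg \<open>0 < c\<close> by (simp add: add_nonneg_pos)
    ultimately show "\<exists>c>0. \<forall>n. \<forall>t\<in>{a..b}. norm (nth_vector_derivative {0<..} (\<lambda>t. exp_family t f) n t) \<le> c * \<alpha> ^ n * m n"
      by blast
  qed
  then show ?thesis
    unfolding generates_carleman_semigroup_def carleman_semigroup_def
    using C0_semigroup_exp generator_exp by metis
qed

end

section \<open>Growth on the spectrum of the generator\<close>

context
  fixes m :: "nat \<Rightarrow> real" and T :: "real \<Rightarrow> 'a \<Rightarrow> 'a"
  assumes C0: "C0_semigroup T" and smooth: "\<And>f. (\<lambda>t. T t f) \<in> carleman_beurling m {0<..}"
    and gen: "A = generator T"
begin

abbreviation "orbit_derivative f \<equiv> nth_vector_derivative {0<..} (\<lambda>t. T t f)"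

lemma orbit_derivative:
  assumes "0 < t"
  shows "(orbit_derivative f n has_vector_derivative orbit_derivative f (Suc n) t) (at t)"
proof -
  have "orbit_derivative f n differentiable (at t within {0<..})"
    using smooth[of f] assms by (auto simp: carleman_beurling_def differentiable_on_def)
  then show ?thesis
    using assms by (simp add: at_within_open[of _ "{0<..}"] vector_derivative_works)
qed

text \<open>
  The generator is a one-sided derivative at \<open>0\<close>; by the semigroup law, differentiability of the
  orbit at \<open>t > 0\<close> puts \<open>T t f\<close> into the domain, for every vector \<open>f\<close>.
\<close>

lemma A_orbit:
  assumes "0 < t"
  shows "A (T t f) = Some (orbit_derivative f 1 t)"
proof -
  have "((\<lambda>s. (T s f - T t f) /\<^sub>R (s - t)) \<longlongrightarrow> orbit_derivative f 1 t) (at t)"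
    using orbit_derivative[OF assms, of f 0] unfolding has_vector_derivative_iff_quotient by simp
  from LIM_offset_zero[OF this]
  have "((\<lambda>h. (T (t + h) f - T t f) /\<^sub>R h) \<longlongrightarrow> orbit_derivative f 1 t) (at 0)"
    by simp
  then have "((\<lambda>h. (T (t + h) f - T t f) /\<^sub>R h) \<longlongrightarrow> orbit_derivative f 1 t) (at_right 0)"
    by (rule tendsto_mono[OF at_le, rotated]) simp
  moreover have "T (t + h) f = T h (T t f)" if "h > 0" for h
    using C0 assms that unfolding C0_semigroup_def by (metis add.commute less_imp_le o_apply)
  ultimately have lim: "((\<lambda>h. (T h (T t f) - T t f) /\<^sub>R h) \<longlongrightarrow> orbit_derivative f 1 t) (at_right 0)"
    by (elim Lim_transform_eventually) (auto simp: eventually_at_filter)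
  then show ?thesis
    unfolding gen generator_def using tendsto_Lim[OF _ lim] by (auto simp: Let_def)
qed

text \<open>
  Uniqueness for a linear differential equation: with \<open>u s = T s f\<close>, the function
  \<open>s \<mapsto> exp ((t - s) A) E u s\<close> on \<open>[0, t]\<close> has derivative \<open>0\<close>, where \<open>A\<close> is bounded on the
  range of \<open>E = E (core n)\<close>. The values at the two ends are the two sides of the claim.
\<close>

lemma E_core_orbit:
  assumes "0 < t"
  shows "E (core n) (T t f) = integral_on (core n) (\<lambda>z. exp (t *\<^sub>R z)) f"
proof -
  define \<phi> where "\<phi> s = integral_on (core n) (\<lambda>z. exp ((t - s) *\<^sub>R z)) (T s f)" for s
  have le: "cmod (exp ((t - s) *\<^sub>R z)) \<le> exp (t * n)" if "s \<in> {0..t}" "z \<in> core n" for s z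
  proof -
    have "(t - s) * Re z \<le> (t - s) * n" "(t - s) * n \<le> t * n"
      using that abs_Re_le_cmod[of z] by (auto simp: core_def intro!: mult_left_mono mult_right_mono)
    then show ?thesis by simp
  qed
  have "\<phi> t = \<phi> 0"
  proof (rule has_derivative_zero_unique_strong_interval[of "{0, t}" 0 t \<phi>])
    show "continuous_on {0..t} \<phi>"
      unfolding continuous_on_def \<phi>_def
    proof
      fix s assume s: "s \<in> {0..t}"
      show "((\<lambda>s. integral_on (core n) (\<lambda>z. exp ((t - s) *\<^sub>R z)) (T s f)) \<longlongrightarrow> 
        integral_on (core n) (\<lambda>z. exp ((t - s) *\<^sub>R z)) (T s f)) (at s within {0..t})"
      proof (rule dominated_convergence_at)
        show "\<forall>\<^sub>F s in at s within {0..t}. \<forall>z\<in>core n. cmod (exp ((t - s) *\<^sub>R z)) \<le> exp (t * n)"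
          using le by (auto simp: eventually_at_filter simp del: norm_exp_eq_Re intro!: always_eventually)
        have "continuous_on {0..} (\<lambda>t. T t f)"
          using C0 by (simp add: C0_semigroup_def)
        then have "continuous_on {0..t} (\<lambda>t. T t f)"
          by (rule continuous_on_subset) auto
        then show "((\<lambda>s. T s f) \<longlongrightarrow> T s f) (at s within {0..t})"
          using s by (simp add: continuous_on_def)
      qed (auto intro!: tendsto_intros)
    qed
    fix s assume "s \<in> {0..t} - {0, t}"
    then have s: "0 < s" "s < t" by auto
    have ok: "bounded_borel_on (core n) (\<lambda>z. exp (r *\<^sub>R z))" for r
      by (rule bounded_borel_on_exp)
    define d where "d = integral_on (core n) (\<lambda>z. z * exp ((t - s) *\<^sub>R z)) (T s f)"
    have "((\<lambda>r. integral_on (core n) (\<lambda>z. exp ((t - r) *\<^sub>R z)) ((T r f - T s f) /\<^sub>R (r - s))) \<longlongrightarrow> 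
        integral_on (core n) (\<lambda>z. exp ((t - s) *\<^sub>R z)) (orbit_derivative f 1 s)) (at s)"
    proof (rule dominated_convergence_at)
      show "\<forall>\<^sub>F r in at s. \<forall>z\<in>core n. cmod (exp ((t - r) *\<^sub>R z)) \<le> exp (t * n)"
        unfolding eventually_at_topological using le s
        by (intro exI[of _ "{0<..<t}"]) (auto simp del: norm_exp_eq_Re)
      show "((\<lambda>r. (T r f - T s f) /\<^sub>R (r - s)) \<longlongrightarrow> orbit_derivative f 1 s) (at s)"
        using orbit_derivative[OF s(1), of f 0] unfolding has_vector_derivative_iff_quotient by simp
    qed (auto intro!: tendsto_intros)
    moreover have "integral_on (core n) (\<lambda>z. exp ((t - s) *\<^sub>R z)) (orbit_derivative f 1 s) = d"
    proof -
      have "integral_on (core n) (\<lambda>z. exp ((t - s) *\<^sub>R z)) (orbit_derivative f 1 s) =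
          integral_on (core n) (\<lambda>z. exp ((t - s) *\<^sub>R z)) (E (core n) (orbit_derivative f 1 s))"
        by (simp add: integral_on_E ok)
      also have "E (core n) (orbit_derivative f 1 s) = integral_on (core n) (\<lambda>z. z) (T s f)"
        using A_orbit[OF s(1)] by (simp add: A_Some_iff)
      finally show ?thesis
        by (simp add: d_def integral_on_mult ok bounded_borel_on_ident mult.commute)
    qed
    ultimately have 1: "((\<lambda>r. integral_on (core n) (\<lambda>z. exp ((t - r) *\<^sub>R z)) ((T r f - T s f) /\<^sub>R (r - s))) \<longlongrightarrow> d) (at s)"
      by simp
    have "((\<lambda>r. t - r) has_vector_derivative 0 - 1) (at s)"
      by (intro has_vector_derivative_diff has_vector_derivative_const has_vector_derivative_id)
    moreover have "((\<lambda>r. integral_on (core n) (\<lambda>z. exp (r *\<^sub>R z)) (T s f)) has_vector_derivative d) (at (t - s))"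
      using has_vector_derivative_core[of n 0] by (simp add: d_def)
    ultimately have "((\<lambda>r. integral_on (core n) (\<lambda>z. exp ((t - r) *\<^sub>R z)) (T s f)) has_vector_derivative - d) (at s)"
      using vector_diff_chain_at[of "\<lambda>r. t - r" "-1" s "\<lambda>r. integral_on (core n) (\<lambda>z. exp (r *\<^sub>R z)) (T s f)" d]
      by (simp add: o_def)
    then have 2: "((\<lambda>r. (integral_on (core n) (\<lambda>z. exp ((t - r) *\<^sub>R z)) (T s f) - 
        integral_on (core n) (\<lambda>z. exp ((t - s) *\<^sub>R z)) (T s f)) /\<^sub>R (r - s)) \<longlongrightarrow> - d) (at s)"
      unfolding has_vector_derivative_iff_quotient .
    have "integral_on (core n) (\<lambda>z. exp ((t - r) *\<^sub>R z)) ((T r f - T s f) /\<^sub>R (r - s)) +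
      (integral_on (core n) (\<lambda>z. exp ((t - r) *\<^sub>R z)) (T s f) - 
        integral_on (core n) (\<lambda>z. exp ((t - s) *\<^sub>R z)) (T s f)) /\<^sub>R (r - s) = (\<phi> r - \<phi> s) /\<^sub>R (r - s)" for r
    proof -
      interpret bounded_linear "integral_on (core n) (\<lambda>z. exp ((t - r) *\<^sub>R z))"
        by (intro bounded_clinear_bounded_linear integral_on_bounded_clinear ok)
      show ?thesis
        by (simp add: \<phi>_def diff scaleR scaleR_diff_right)
    qed
    with tendsto_add[OF 1 2] have "(\<phi> has_vector_derivative 0) (at s)"
      unfolding has_vector_derivative_iff_quotient by simp
    then show "(\<phi> has_derivative (\<lambda>h. 0)) (at s within {0..t})"
      by (simp add: has_vector_derivative_def has_derivative_at_withinI)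
  qed (use assms in auto)
  moreover have "T 0 f = f"
    using C0 by (simp add: C0_semigroup_def)
  ultimately show ?thesis
    by (simp add: \<phi>_def integral_on_one)
qed

lemma E_core_orbit_derivative:
  "0 < t \<Longrightarrow> E (core n) (orbit_derivative f k t) = integral_on (core n) (\<lambda>z. z ^ k * exp (t *\<^sub>R z)) f"
proof (induction k arbitrary: t)
  case 0
  then show ?case by (simp add: E_core_orbit)
next
  case (Suc k)
  have "((\<lambda>s. E (core n) (orbit_derivative f k s)) has_vector_derivative E (core n) (orbit_derivative f (Suc k) t)) (at t)"
    by (intro bounded_linear.has_vector_derivative[OF _ orbit_derivative[OF Suc.prems]]
        bounded_clinear_bounded_linear bounded_clinear_E) simp
  moreover have "((\<lambda>s. E (core n) (orbit_derivative f k s)) has_vector_derivative 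
      integral_on (core n) (\<lambda>z. z ^ Suc k * exp (t *\<^sub>R z)) f) (at t)"
    by (rule has_vector_derivative_transform_within_open[OF has_vector_derivative_core, where S = "{0<..}"])
      (use Suc in auto)
  ultimately show ?case
    by (rule vector_derivative_unique_at)
qed

text \<open>
  The operators \<open>A\<^sup>k exp (t A) E (core n)\<close>, divided by \<open>\<alpha>\<^sup>k m\<^sub>k\<close>, are pointwise bounded in both \<open>k\<close> and
  \<open>n\<close> because they are projections of derivatives of orbits; so they are uniformly bounded.
\<close>

lemma orbit_spectral_growth:
  assumes m: "\<And>n. 0 < m n" and "0 < t" "0 < \<alpha>"
  shows "\<exists>c. \<forall>k. \<forall>z\<in>spectrum A. cmod z ^ k * exp (t * Re z) \<le> c * \<alpha> ^ k * m k"
proof -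
  define L where "L = (\<lambda>(k, n) g. integral_on (core n) (\<lambda>z. z ^ k * exp (t *\<^sub>R z)) g /\<^sub>R (\<alpha> ^ k * m k))"
  have ok: "bounded_borel_on (core n) (\<lambda>z. z ^ k * exp (t *\<^sub>R z))" for n k
    by (intro bounded_borel_on_mult bounded_borel_on_power bounded_borel_on_exp)
  have pos: "\<alpha> ^ k * m k > 0" for k
    using m[of k] \<open>0 < \<alpha>\<close> by simp
  obtain K where K: "K \<ge> 0" "\<And>D f. D \<in> sets borel \<Longrightarrow> norm (E D f) \<le> K * norm f"
    using E_uniformly_bounded by blast
  have "\<exists>c\<ge>0. \<forall>i\<in>UNIV. \<forall>g. norm (L i g) \<le> c * norm g"
  proof (rule uniform_boundedness)
    show "bounded_linear (L i)" for i
      unfolding L_def split_beta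
      by (intro bounded_linear_compose[OF bounded_linear_scaleR_right] bounded_clinear_bounded_linear
          integral_on_bounded_clinear ok)
    show "\<exists>c. \<forall>i\<in>UNIV. norm (L i f) \<le> c" for f
    proof -
      have "\<forall>a b. a \<le> b \<longrightarrow> {a..b} \<subseteq> {0<..} \<longrightarrow> (\<forall>\<alpha>>0. \<exists>c>0. \<forall>n. \<forall>t\<in>{a..b}.
          norm (orbit_derivative f n t) \<le> c * \<alpha> ^ n * m n)"
        using smooth[of f] by (simp add: carleman_beurling_def)
      from this[rule_format, of t t \<alpha>]
      have "\<exists>c>0. \<forall>n. \<forall>t\<in>{t..t}. norm (orbit_derivative f n t) \<le> c * \<alpha> ^ n * m n"
        using \<open>0 < t\<close> \<open>0 < \<alpha>\<close> by simp
      then obtain c where c: "\<And>k. norm (orbit_derivative f k t) \<le> c * (\<alpha> ^ k * m k)"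
        by (auto simp: mult.assoc)
      have "norm (L (k, n) f) \<le> K * c" for k n
      proof -
        have "norm (integral_on (core n) (\<lambda>z. z ^ k * exp (t *\<^sub>R z)) f) \<le> K * norm (orbit_derivative f k t)"
          using K(2)[of "core n"] by (simp add: E_core_orbit_derivative[OF \<open>0 < t\<close>, symmetric])
        also have "\<dots> \<le> K * (c * (\<alpha> ^ k * m k))"
          using K(1) c by (intro mult_left_mono)
        finally have "norm (integral_on (core n) (\<lambda>z. z ^ k * exp (t *\<^sub>R z)) f) / (\<alpha> ^ k * m k) \<le> K * c"
          using pos[of k] by (simp add: pos_divide_le_eq mult.assoc)
        moreover have "norm (L (k, n) f) = norm (integral_on (core n) (\<lambda>z. z ^ k * exp (t *\<^sub>R z)) f) / (\<alpha> ^ k * m k)"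
          unfolding L_def prod.case norm_scaleR abs_inverse abs_of_pos[OF pos] by (simp only: divide_inverse mult.commute)
        ultimately show ?thesis by simp
      qed
      then show ?thesis by auto
    qed
  qed
  then obtain c where c: "\<And>k n g. norm (L (k, n) g) \<le> c * norm g"
    by blast
  have "cmod z ^ k * exp (t * Re z) \<le> c * \<alpha> ^ k * m k" if z: "z \<in> spectrum A" for z k
  proof -
    have "norm (integral_on (core n) (\<lambda>z. z ^ k * exp (t *\<^sub>R z)) g) \<le> c * (\<alpha> ^ k * m k) * norm g" for n g
    proof -
      have "norm (integral_on (core n) (\<lambda>z. z ^ k * exp (t *\<^sub>R z)) g) = norm (L (k, n) g) * (\<alpha> ^ k * m k)"
      proof -
        have "x = inverse r * x * r" if "r > 0" for x r :: real
          using that by simp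
        from this[OF pos] show ?thesis
          unfolding L_def prod.case norm_scaleR abs_inverse abs_of_pos[OF pos] .
      qed
      also have "\<dots> \<le> c * norm g * (\<alpha> ^ k * m k)"
        using pos[of k] by (intro mult_right_mono c) simp
      finally show ?thesis by (simp add: mult_ac)
    qed
    then have "cmod (z ^ k * exp (t *\<^sub>R z)) \<le> c * (\<alpha> ^ k * m k)"
      by (intro spectral_value_le[OF z ok]) (auto intro!: continuous_intros)
    then show ?thesis
      by (simp add: norm_mult norm_power mult.assoc)
  qed
  then show ?thesis by blast
qed

end

theorem generates_carleman_semigroup_imp_growth:
  assumes "\<And>n. 0 < m n" "generates_carleman_semigroup m A" "0 < t" "0 < \<alpha>"
  shows "\<exists>c. \<forall>k. \<forall>z\<in>spectrum A. cmod z ^ k * exp (t * Re z) \<le> c * \<alpha> ^ k * m k"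
  using assms orbit_spectral_growth unfolding generates_carleman_semigroup_def carleman_semigroup_def by blast

end

section \<open>The function associated with a sequence\<close>

lemma power_le_fact_exp:
  fixes u :: real
  assumes "0 \<le> u"
  shows "u ^ n \<le> fact n * exp u"
proof -
  have "sum (\<lambda>n. u ^ n /\<^sub>R fact n) {n} \<le> suminf (\<lambda>n. u ^ n /\<^sub>R fact n)"
    using assms sums_summable[OF exp_converges[of u]] by (intro sum_le_suminf) auto
  then show ?thesis
    using sums_unique[OF exp_converges[of u]] by (simp add: field_simps)
qed

definition spectral_bound :: "complex set \<Rightarrow> (real \<Rightarrow> real) \<Rightarrow> bool" where
  "spectral_bound \<sigma> Q \<longleftrightarrow> (\<forall>b>0. \<exists>a. \<forall>z\<in>\<sigma>. Re z \<le> a - b * Q \<bar>Im z\<bar>)"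

text \<open>
  An additive constant goes into \<open>a\<close> and a factor into \<open>b\<close>, so only the growth of \<open>Q\<close> up to an
  affine change matters.
\<close>

lemma spectral_bound_transfer:
  assumes Q: "spectral_bound \<sigma> Q" and "0 < B" and le: "\<And>x. 0 \<le> x \<Longrightarrow> P x \<le> C + B * Q x"
  shows "spectral_bound \<sigma> P"
  unfolding spectral_bound_def
proof (intro allI impI)
  fix b :: real assume "0 < b"
  then obtain a where a: "\<And>z. z \<in> \<sigma> \<Longrightarrow> Re z \<le> a - (b * B) * Q \<bar>Im z\<bar>"
    using Q \<open>0 < B\<close> unfolding spectral_bound_def by (meson mult_pos_pos)
  have "Re z \<le> (a + b * C) - b * P \<bar>Im z\<bar>" if "z \<in> \<sigma>" for z
  proof -
    have "b * P \<bar>Im z\<bar> \<le> b * (C + B * Q \<bar>Im z\<bar>)"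
      using \<open>0 < b\<close> by (intro mult_left_mono le) auto
    with a[OF that] show ?thesis by (simp add: algebra_simps)
  qed
  then show "\<exists>a. \<forall>z\<in>\<sigma>. Re z \<le> a - b * P \<bar>Im z\<bar>" by blast
qed

locale carleman_sequence =
  fixes m :: "nat \<Rightarrow> real"
  assumes pos: "0 < m n" and SGR: "SGR m"
begin

abbreviation "T \<equiv> carleman_T m"
abbreviation "M \<equiv> carleman_M m"

lemma summable_T: "summable (\<lambda>n. x ^ n / m n)"
proof -
  obtain c where "c > 0" and c: "\<And>n. c * fact n \<le> m n"
    using SGR unfolding SGR_def by (metis mult.right_neutral power_one zero_less_one)
  have "norm (x ^ n / m n) \<le> (1 / c) * (inverse (fact n) * \<bar>x\<bar> ^ n)" for n
  proof -
    have "norm (x ^ n / m n) = \<bar>x\<bar> ^ n / m n"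
      using pos[of n] by (simp add: power_abs)
    also have "\<dots> \<le> \<bar>x\<bar> ^ n / (c * fact n)"
      using c[of n] \<open>c > 0\<close> by (intro divide_left_mono) (auto intro!: mult_pos_pos pos)
    finally show ?thesis by (simp add: divide_inverse mult_ac)
  qed
  moreover have "summable (\<lambda>n. (1 / c) * (inverse (fact n) * \<bar>x\<bar> ^ n))"
    by (intro summable_mult summable_exp)
  ultimately show ?thesis
    by (meson summable_comparison_test')
qed

lemma T_ge_term: 
  assumes "0 \<le> x"
  shows "m 0 * (x ^ n / m n) \<le> T x"
proof -
  have "0 \<le> x ^ k / m k" for k
    using assms pos[of k] by simp
  then have "sum (\<lambda>n. x ^ n / m n) {n} \<le> (\<Sum>n. x ^ n / m n)"
    by (intro sum_le_suminf summable_T) auto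
  then show ?thesis
    unfolding carleman_T_def using pos[of 0] by (intro mult_left_mono) auto
qed

lemma T_ge_1: "0 \<le> x \<Longrightarrow> 1 \<le> T x"
  using T_ge_term[of x 0] pos[of 0] by simp

lemma T_mono: "0 \<le> x \<Longrightarrow> x \<le> y \<Longrightarrow> T x \<le> T y"
  unfolding carleman_T_def using pos
  by (intro mult_left_mono suminf_le summable_T divide_right_mono power_mono) (auto intro: less_imp_le)

lemma M_nonneg: "0 \<le> x \<Longrightarrow> 0 \<le> M x"
  using T_ge_1[of x] by (simp add: carleman_M_def)

lemma M_mono: "0 \<le> x \<Longrightarrow> x \<le> y \<Longrightarrow> M x \<le> M y"
  using T_ge_1[of x] T_ge_1[of y] T_mono[of x y] by (simp add: carleman_M_def)

lemma exp_M: "0 \<le> x \<Longrightarrow> exp (M x) = T x"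
  using T_ge_1[of x] by (simp add: carleman_M_def)

text \<open>
  The terms of the Cauchy product of the series of \<open>x\<^sup>n / m\<^sub>n\<close> with itself are \<open>x\<^sup>n / m\<^sub>n\<close> times the
  sums that the hypothesis on \<open>l\<close> and \<open>h\<close> bounds from below.
\<close>

lemma T_dilate_square:
  assumes h: "0 \<le> h" and l: "\<And>n. l * h ^ n \<le> (\<Sum>k\<le>n. m n / (m k * m (n - k)))" and "0 \<le> x"
  shows "m 0 * l * T (h * x) \<le> (T x)\<^sup>2"
proof -
  define a where "a n = x ^ n / m n" for n
  have a: "summable a" "summable (\<lambda>n. norm (a n))"
    using summable_T[of x] pos \<open>0 \<le> x\<close> by (auto simp: a_def[abs_def] abs_of_pos power_abs)
  have "l * ((h * x) ^ n / m n) \<le> (\<Sum>k\<le>n. a k * a (n - k))" for n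
  proof -
    have "l * ((h * x) ^ n / m n) = (l * h ^ n) * (x ^ n / m n)"
      by (simp add: power_mult_distrib)
    also have "\<dots> \<le> (\<Sum>k\<le>n. m n / (m k * m (n - k))) * (x ^ n / m n)"
      using l[of n] pos[of n] \<open>0 \<le> x\<close> by (intro mult_right_mono) auto
    also have "\<dots> = (\<Sum>k\<le>n. a k * a (n - k))"
      unfolding sum_distrib_right
    proof (rule sum.cong)
      fix k assume "k \<in> {..n}"
      then have "x ^ n = x ^ k * x ^ (n - k)" by (simp flip: power_add)
      then show "m n / (m k * m (n - k)) * (x ^ n / m n) = a k * a (n - k)"
        using pos[of n] by (simp add: a_def)
    qed simp
    finally show ?thesis .
  qed
  then have "(\<Sum>n. l * ((h * x) ^ n / m n)) \<le> (\<Sum>n. \<Sum>k\<le>n. a k * a (n - k))"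
    using a by (intro suminf_le summable_mult summable_T summable_Cauchy_product)
  also have "\<dots> = (\<Sum>n. a n)\<^sup>2"
    using Cauchy_product[OF a(2) a(2)] by (simp add: power2_eq_square)
  finally have "l * (\<Sum>n. (h * x) ^ n / m n) \<le> (\<Sum>n. a n)\<^sup>2"
    using suminf_mult[OF summable_T, of l "h * x"] by simp
  then have "(m 0)\<^sup>2 * (l * (\<Sum>n. (h * x) ^ n / m n)) \<le> (m 0)\<^sup>2 * (\<Sum>n. a n)\<^sup>2"
    by (intro mult_left_mono) auto
  then show ?thesis
    by (simp add: carleman_T_def a_def[abs_def] power2_eq_square mult_ac)
qed

text \<open>
  Taking logarithms, \<open>M (h x)\<close> is at most \<open>2 M x\<close> plus a constant; iteration reaches any factor
  since \<open>h > 1\<close>.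
\<close>

lemma M_dilate:
  assumes "BC m" "0 \<le> r"
  shows "\<exists>B>0. \<exists>C. \<forall>x\<ge>0. M (r * x) \<le> C + B * M x"
proof -
  obtain h l where "h > 1" "l > 0" and l: "\<And>n. l * h ^ n \<le> (\<Sum>k\<le>n. m n / (m k * m (n - k)))"
    using \<open>BC m\<close> unfolding BC_def by blast
  have step: "M (h * x) \<le> - ln (m 0 * l) + 2 * M x" if "0 \<le> x" for x
  proof -
    have "0 < m 0 * l" "0 < T (h * x)" "0 < T x"
      using pos[of 0] \<open>l > 0\<close> T_ge_1[of "h * x"] T_ge_1[of x] that \<open>h > 1\<close> by auto
    moreover from this have "ln (m 0 * l * T (h * x)) \<le> ln ((T x)\<^sup>2)"
      using T_dilate_square[of h l x] l that \<open>h > 1\<close> by (subst ln_le_cancel_iff) auto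
    ultimately show ?thesis
      by (simp add: ln_mult_pos ln_realpow carleman_M_def)
  qed
  have iter: "\<exists>C. \<forall>x\<ge>0. M (h ^ k * x) \<le> C + 2 ^ k * M x" for k
  proof (induction k)
    case 0
    then show ?case by (intro exI[of _ 0]) simp
  next
    case (Suc k)
    then obtain C where C: "\<And>x. 0 \<le> x \<Longrightarrow> M (h ^ k * x) \<le> C + 2 ^ k * M x" by blast
    have "M (h ^ Suc k * x) \<le> (- ln (m 0 * l) + 2 * C) + 2 ^ Suc k * M x" if "0 \<le> x" for x
      using step[of "h ^ k * x"] C[OF that] that \<open>h > 1\<close> by (simp add: mult.assoc)
    then show ?case by blast
  qed
  obtain k where k: "r < h ^ k"
    using real_arch_pow[OF \<open>h > 1\<close>] by blast
  obtain C where C: "\<And>x. 0 \<le> x \<Longrightarrow> M (h ^ k * x) \<le> C + 2 ^ k * M x"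
    using iter by blast
  have "M (r * x) \<le> C + 2 ^ k * M x" if "0 \<le> x" for x
    using M_mono[of "r * x" "h ^ k * x"] C[OF that] k \<open>0 \<le> r\<close> that by (simp add: mult_right_mono)
  then show ?thesis by (intro exI[of _ "2 ^ k"] exI[of _ C] conjI) auto
qed

section \<open>Spectral bounds and growth estimates\<close>

text \<open>
  Real and imaginary parts of \<open>z\<close> are estimated separately, each with \<open>\<beta> = \<alpha> / 2\<close>, because
  \<open>\<bar>z\<bar>\<^sup>n\<close> is at most \<open>2\<^sup>n\<close> times the sum of their \<open>n\<close>-th powers.
\<close>

lemma growth_of_spectral_bound:
  assumes "BC m" and bound: "spectral_bound \<sigma> M" and "0 < p" "p \<le> q" "0 < \<alpha>"
  shows "\<exists>c>0. \<forall>n. \<forall>t\<in>{p..q}. \<forall>z\<in>\<sigma>. cmod z ^ n * exp (t * Re z) \<le> c * \<alpha> ^ n * m n"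
proof -
  define \<beta> where "\<beta> = \<alpha> / 2"
  have "0 < \<beta>" using \<open>0 < \<alpha>\<close> by (simp add: \<beta>_def)
  obtain B C where "0 < B" and C: "\<And>x. 0 \<le> x \<Longrightarrow> M (1 / \<beta> * x) \<le> C + B * M x"
    using M_dilate[OF \<open>BC m\<close>, of "1 / \<beta>"] \<open>0 < \<beta>\<close> by auto
  \<comment> \<open>this choice of \<open>b\<close> makes the factor of \<open>M\<close> at least \<open>B\<close> at every time \<open>t \<ge> p\<close>\<close>
  have "0 < B / p" using \<open>0 < B\<close> \<open>0 < p\<close> by simp
  then obtain a where a: "\<And>z. z \<in> \<sigma> \<Longrightarrow> Re z \<le> a - B / p * M \<bar>Im z\<bar>"
    using bound unfolding spectral_bound_def by blast
  \<comment> \<open>with this parameter, \<open>n! / p\<^sup>n\<close> is bounded by a multiple of \<open>\<beta>\<^sup>n m\<^sub>n\<close>\<close>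
  obtain c where "c > 0" and c: "\<And>n. c * (1 / (p * \<beta>)) ^ n * fact n \<le> m n"
    using SGR \<open>0 < p\<close> \<open>0 < \<beta>\<close> unfolding SGR_def by (metis mult_pos_pos zero_less_divide_1_iff)
  define c1 where "c1 = exp (2 * q * \<bar>a\<bar>) / c"
  define c2 where "c2 = exp (C + q * \<bar>a\<bar>) / m 0"
  have "c1 > 0" "c2 > 0" using \<open>c > 0\<close> pos[of 0] by (auto simp: c1_def c2_def)
  have "cmod z ^ n * exp (t * Re z) \<le> (c1 + c2) * \<alpha> ^ n * m n" if t: "t \<in> {p..q}" and z: "z \<in> \<sigma>" for n t z
  proof -
    define x y where "x = \<bar>Re z\<bar>" and "y = \<bar>Im z\<bar>"
    have xy: "0 \<le> x" "0 \<le> y" by (auto simp: x_def y_def)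
    have "0 < t" "0 \<le> q" using t \<open>0 < p\<close> by auto
    have M0: "0 \<le> M y" using M_nonneg xy by simp
    have "0 \<le> B / p * M y" using \<open>0 < B / p\<close> M0 by (intro mult_nonneg_nonneg) auto
    then have Re_le: "Re z \<le> \<bar>a\<bar>"
      using a[OF z] by (simp add: y_def)
    have Re: "x ^ n * exp (t * Re z) \<le> c1 * (\<beta> ^ n * m n)"
    proof -
      \<comment> \<open>a negative real part is compensated by \<open>t \<ge> p\<close>, a positive one is at most \<open>\<bar>a\<bar>\<close>\<close>
      have px: "p * x + t * Re z \<le> 2 * q * \<bar>a\<bar>"
      proof (cases "0 \<le> Re z")
        case True
        then have "p * x \<le> q * \<bar>a\<bar>" "t * Re z \<le> q * \<bar>a\<bar>"
          using t \<open>0 < t\<close> \<open>0 < p\<close> Re_le by (auto simp: x_def intro!: mult_mono)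
        then show ?thesis by simp
      next
        case False
        then have "p * x \<le> t * x"
          using t xy by (intro mult_right_mono) auto
        also have "t * x = - (t * Re z)" using False by (simp add: x_def)
        finally have "p * x + t * Re z \<le> 0" by simp
        also have "0 \<le> 2 * q * \<bar>a\<bar>" using \<open>0 \<le> q\<close> by simp
        finally show ?thesis .
      qed
      have "c * (fact n / (p * \<beta>) ^ n) \<le> m n"
        using c[of n] by (simp add: power_one_over field_simps)
      then have fact_le: "fact n \<le> (p * \<beta>) ^ n * m n / c"
        using \<open>c > 0\<close> \<open>0 < p\<close> \<open>0 < \<beta>\<close> by (simp add: field_simps)
      have "p ^ n * (x ^ n * exp (t * Re z)) = (p * x) ^ n * exp (t * Re z)"
        by (simp add: power_mult_distrib)
      also have "\<dots> \<le> fact n * exp (p * x) * exp (t * Re z)"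
        using \<open>0 < p\<close> xy by (intro mult_right_mono power_le_fact_exp) auto
      also have "\<dots> = fact n * exp (p * x + t * Re z)"
        by (simp add: exp_add)
      also have "\<dots> \<le> ((p * \<beta>) ^ n * m n / c) * exp (2 * q * \<bar>a\<bar>)"
        using px fact_le \<open>c > 0\<close> \<open>0 < p\<close> \<open>0 < \<beta>\<close> pos[of n] by (intro mult_mono) auto
      also have "\<dots> = p ^ n * (c1 * (\<beta> ^ n * m n))"
        by (simp add: c1_def power_mult_distrib)
      finally show ?thesis using \<open>0 < p\<close> by simp
    qed
    have Im: "y ^ n * exp (t * Re z) \<le> c2 * (\<beta> ^ n * m n)"
    proof -
      have "t * Re z \<le> t * (a - B / p * M y)"
        using a[OF z] \<open>0 < t\<close> by (intro mult_left_mono) (auto simp: y_def)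
      also have "\<dots> = t * a - t / p * (B * M y)" by (simp add: algebra_simps)
      also have "\<dots> \<le> q * \<bar>a\<bar> - 1 * (B * M y)"
        using t \<open>0 < t\<close> \<open>0 < p\<close> \<open>0 < B\<close> M0 
        by (intro diff_mono mult_right_mono) (auto intro: order_trans[OF mult_left_mono[of a "\<bar>a\<bar>"] mult_right_mono])
      finally have tz: "t * Re z \<le> q * \<bar>a\<bar> - B * M y" by simp
      have "m 0 * ((y / \<beta>) ^ n / m n) \<le> exp (M (1 / \<beta> * y))"
        using T_ge_term[of "y / \<beta>" n] xy \<open>0 < \<beta>\<close> by (simp add: exp_M)
      also have "\<dots> \<le> exp (C + B * M y)"
        using C[OF xy(2)] by simp
      finally have "y ^ n \<le> \<beta> ^ n * m n / m 0 * exp (C + B * M y)"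
        using pos[of 0] pos[of n] \<open>0 < \<beta>\<close> by (simp add: field_simps)
      then have "y ^ n * exp (t * Re z) \<le> \<beta> ^ n * m n / m 0 * exp (C + B * M y) * exp (q * \<bar>a\<bar> - B * M y)"
        using tz xy pos[of 0] pos[of n] \<open>0 < \<beta>\<close> by (intro mult_mono) auto
      also have "\<dots> = c2 * (\<beta> ^ n * m n)"
        by (simp add: c2_def mult.assoc flip: exp_add)
      finally show ?thesis .
    qed
    have "cmod z \<le> 2 * max x y"
      using cmod_le[of z] by (simp add: x_def y_def)
    then have "cmod z ^ n \<le> (2 * max x y) ^ n" by (rule power_mono) simp
    also have "\<dots> \<le> 2 ^ n * (x ^ n + y ^ n)"
      using xy by (simp add: power_mult_distrib max_def)
    finally have "cmod z ^ n * exp (t * Re z) \<le> 2 ^ n * (x ^ n + y ^ n) * exp (t * Re z)"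
      by (rule mult_right_mono) simp
    also have "\<dots> = 2 ^ n * (x ^ n * exp (t * Re z) + y ^ n * exp (t * Re z))"
      by (simp add: algebra_simps)
    also have "\<dots> \<le> 2 ^ n * (c1 * (\<beta> ^ n * m n) + c2 * (\<beta> ^ n * m n))"
      using Re Im by (intro mult_left_mono add_mono) auto
    also have "\<dots> = (c1 + c2) * \<alpha> ^ n * m n"
      by (simp add: \<beta>_def power_divide algebra_simps)
    finally show ?thesis .
  qed
  then show ?thesis
    using \<open>c1 > 0\<close> \<open>c2 > 0\<close> by (intro exI[of _ "c1 + c2"]) auto
qed

text \<open>
  With \<open>t = 1 / b\<close>, the factor \<open>(1 / 2)\<^sup>k\<close> makes the estimates summable over \<open>k\<close>, and the sum of the
  left-hand sides is \<open>T\<close> up to a constant.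
\<close>

lemma spectral_bound_of_growth:
  assumes growth: "\<And>t. 0 < t \<Longrightarrow> \<exists>c. \<forall>k. \<forall>z\<in>\<sigma>. cmod z ^ k * exp (t * Re z) \<le> c * (1 / 2) ^ k * m k"
  shows "spectral_bound \<sigma> M"
  unfolding spectral_bound_def
proof (intro allI impI)
  fix b :: real assume "0 < b"
  define t where "t = 1 / b"
  obtain c where c: "\<And>k z. z \<in> \<sigma> \<Longrightarrow> cmod z ^ k * exp (t * Re z) \<le> c * (1 / 2) ^ k * m k"
    using growth[of t] \<open>0 < b\<close> by (auto simp: t_def)
  have "Re z \<le> b * ln (2 * \<bar>c\<bar> * m 0) - b * M \<bar>Im z\<bar>" if z: "z \<in> \<sigma>" for z
  proof -
    define y where "y = \<bar>Im z\<bar>"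
    have y: "0 \<le> y" "y \<le> cmod z" by (auto simp: y_def abs_Im_le_cmod)
    have "y ^ k / m k \<le> (\<bar>c\<bar> * exp (- t * Re z)) * (1 / 2) ^ k" for k
    proof -
      have "y ^ k * exp (t * Re z) \<le> cmod z ^ k * exp (t * Re z)"
        using y by (intro mult_right_mono power_mono) auto
      also have "\<dots> \<le> \<bar>c\<bar> * (1 / 2) ^ k * m k"
        using pos[of k] by (intro order_trans[OF c[OF z]] mult_right_mono) auto
      finally show ?thesis
        using pos[of k] by (simp add: exp_minus field_simps)
    qed
    then have "(\<Sum>k. y ^ k / m k) \<le> (\<Sum>k. (\<bar>c\<bar> * exp (- t * Re z)) * (1 / 2) ^ k)"
      by (intro suminf_le summable_T summable_mult summable_geometric) auto
    also have "\<dots> = (\<bar>c\<bar> * exp (- t * Re z)) * 2"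
      by (subst suminf_mult) (auto simp: suminf_geometric)
    finally have "T y \<le> 2 * \<bar>c\<bar> * m 0 * exp (- t * Re z)"
      unfolding carleman_T_def using pos[of 0] by (simp add: mult_ac)
    moreover have "1 \<le> T y" using T_ge_1 y by simp
    ultimately have "0 < 2 * \<bar>c\<bar> * m 0" "M y \<le> ln (2 * \<bar>c\<bar> * m 0 * exp (- t * Re z))"
      unfolding carleman_M_def using pos[of 0] by (auto simp: zero_less_mult_iff intro!: ln_mono)
    then have "M y \<le> ln (2 * \<bar>c\<bar> * m 0) - t * Re z"
      by (simp add: ln_mult_pos)
    then have "b * M y \<le> b * (ln (2 * \<bar>c\<bar> * m 0) - t * Re z)"
      using \<open>0 < b\<close> by (intro mult_left_mono) auto
    then show ?thesis
      using \<open>0 < b\<close> by (simp add: t_def y_def algebra_simps)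
  qed
  then show "\<exists>a. \<forall>z\<in>\<sigma>. Re z \<le> a - b * M \<bar>Im z\<bar>" by blast
qed

text \<open>
  The factors \<open>\<gamma>1\<close>, \<open>\<gamma>2\<close> in the argument are removed by \<open>M_dilate\<close>. Below \<open>R\<close> monotonicity
  suffices, and \<open>ln (F 0)\<close> is a lower bound for \<open>ln F\<close>.
\<close>

lemma spectral_bound_replacement:
  assumes "BC m" and F: "T_replacement m F"
  shows "spectral_bound \<sigma> M \<longleftrightarrow> spectral_bound \<sigma> (\<lambda>x. ln (F x))"
proof -
  have Fpos: "\<And>x. 0 \<le> x \<Longrightarrow> 0 < F x" and Fmono: "\<And>x y. 0 \<le> x \<Longrightarrow> x \<le> y \<Longrightarrow> F x \<le> F y"
    using F by (auto simp: T_replacement_def mono_on_def)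
  obtain \<gamma>1 \<gamma>2 c1 c2 R where g: "0 < \<gamma>1" "0 < \<gamma>2" "0 < c1" "0 < c2" "0 \<le> R"
    and low: "\<And>x. x \<ge> R \<Longrightarrow> c1 * F (\<gamma>1 * x) \<le> T x" and up: "\<And>x. x \<ge> R \<Longrightarrow> T x \<le> c2 * F (\<gamma>2 * x)"
    using F unfolding T_replacement_def by blast
  show ?thesis
  proof
    assume M: "spectral_bound \<sigma> M"
    obtain B C where "0 < B" and C: "\<And>x. 0 \<le> x \<Longrightarrow> M (1 / \<gamma>1 * x) \<le> C + B * M x"
      using M_dilate[OF \<open>BC m\<close>, of "1 / \<gamma>1"] g(1) by auto
    show "spectral_bound \<sigma> (\<lambda>x. ln (F x))"
    proof (rule spectral_bound_transfer[OF M \<open>0 < B\<close>])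
      fix y :: real assume "0 \<le> y"
      show "ln (F y) \<le> max (C - ln c1) (ln (F (\<gamma>1 * R))) + B * M y"
      proof (cases "\<gamma>1 * R \<le> y")
        case True
        then have "R \<le> y / \<gamma>1" using g by (simp add: field_simps)
        from low[OF this] have "c1 * F y \<le> T (y / \<gamma>1)" using g by simp
        then have "ln (c1 * F y) \<le> M (y / \<gamma>1)"
          unfolding carleman_M_def using g Fpos[OF \<open>0 \<le> y\<close>] by (intro ln_mono) auto
        then have "ln c1 + ln (F y) \<le> M (y / \<gamma>1)"
          using g Fpos[OF \<open>0 \<le> y\<close>] by (simp add: ln_mult_pos)
        then show ?thesis using C[OF \<open>0 \<le> y\<close>] by simp
      next
        case False
        then have "ln (F y) \<le> ln (F (\<gamma>1 * R))"
          using Fpos Fmono \<open>0 \<le> y\<close> by (intro ln_mono) auto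
        moreover have "0 \<le> B * M y"
          using \<open>0 < B\<close> M_nonneg[OF \<open>0 \<le> y\<close>] by simp
        ultimately show ?thesis by simp
      qed
    qed
  next
    assume lnF: "spectral_bound \<sigma> (\<lambda>x. ln (F x))"
    obtain B C where "0 < B" and C: "\<And>x. 0 \<le> x \<Longrightarrow> M (\<gamma>2 * x) \<le> C + B * M x"
      using M_dilate[OF \<open>BC m\<close>, of "\<gamma>2"] g(2) by auto
    show "spectral_bound \<sigma> M"
    proof (rule spectral_bound_transfer[OF lnF \<open>0 < B\<close>])
      fix y :: real assume "0 \<le> y"
      show "M y \<le> max (C + B * ln c2) (M (\<gamma>2 * R) - B * ln (F 0)) + B * ln (F y)"
      proof (cases "\<gamma>2 * R \<le> y")
        case True
        then have R: "R \<le> y / \<gamma>2" using g by (simp add: field_simps)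
        have "0 < T (y / \<gamma>2)"
          using T_ge_1[of "y / \<gamma>2"] \<open>0 \<le> y\<close> g by simp
        then have "M (y / \<gamma>2) \<le> ln (c2 * F y)"
          unfolding carleman_M_def using up[OF R] g by (intro ln_mono) auto
        also have "\<dots> = ln c2 + ln (F y)"
          using g Fpos[OF \<open>0 \<le> y\<close>] by (simp add: ln_mult_pos)
        finally have "B * M (y / \<gamma>2) \<le> B * (ln c2 + ln (F y))"
          using \<open>0 < B\<close> by simp
        moreover have "M y \<le> C + B * M (y / \<gamma>2)"
          using C[of "y / \<gamma>2"] \<open>0 \<le> y\<close> g by simp
        ultimately show ?thesis by (simp add: algebra_simps)
      next
        case False
        then have "M y \<le> M (\<gamma>2 * R)"
          using \<open>0 \<le> y\<close> by (intro M_mono) auto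
        moreover have "ln (F 0) \<le> ln (F y)"
          using Fpos Fmono \<open>0 \<le> y\<close> by (intro ln_mono) auto
        then have "B * ln (F 0) \<le> B * ln (F y)"
          using \<open>0 < B\<close> by simp
        ultimately show ?thesis by simp
      qed
    qed
  qed
qed

end

section \<open>Characterization of the generators\<close>

theorem theorem3p2:
  fixes m :: "nat \<Rightarrow> real"
    and A :: "'a::complex_banach \<rightharpoonup> 'a"
  assumes "\<And>n. 0 < m n" and "SGR m" and "BC m"
    and "scalar_type_spectral A"
  shows "(generates_carleman_semigroup m A \<longleftrightarrow>
           (\<forall>b>0. \<exists>a. \<forall>z\<in>spectrum A. Re z \<le> a - b * carleman_M m \<bar>Im z\<bar>)) \<and>
         (\<forall>F. T_replacement m F \<longrightarrow>
           (generates_carleman_semigroup m A \<longleftrightarrow>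
             (\<forall>b>0. \<exists>a. \<forall>z\<in>spectrum A. Re z \<le> a - b * ln (F \<bar>Im z\<bar>))))"
proof -
  interpret carleman_sequence m
    using assms by unfold_locales
  obtain E where E: "spectral_measure E" "E (spectrum A) = id" "A = spectral_integral E (spectrum A) (\<lambda>z. z)"
    using assms(4) by (auto simp: scalar_type_spectral_def)
  interpret spectral_operator E A "spectrum A"
    using E by unfold_locales (auto simp: closed_spectrum)
  \<comment> \<open>\<open>M \<ge> 0\<close>, so the bound with \<open>b = 1\<close> puts the spectrum into a left half-plane\<close>
  have "generates_carleman_semigroup m A" if bound: "spectral_bound (spectrum A) M"
  proof -
    obtain a where a: "\<And>z. z \<in> spectrum A \<Longrightarrow> Re z \<le> a - 1 * M \<bar>Im z\<bar>"
      using bound unfolding spectral_bound_def by (meson zero_less_one)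
    have "Re z \<le> \<bar>a\<bar>" if "z \<in> spectrum A" for z
      using a[OF that] M_nonneg[of "\<bar>Im z\<bar>"] by simp
    then show ?thesis
      by (rule generates_carleman_semigroup_exp)
        (simp_all add: pos growth_of_spectral_bound[OF \<open>BC m\<close> bound])
  qed
  moreover have "spectral_bound (spectrum A) M" if "generates_carleman_semigroup m A"
    using generates_carleman_semigroup_imp_growth[OF pos that, of _ "1 / 2"]
    by (intro spectral_bound_of_growth) simp
  ultimately have main: "generates_carleman_semigroup m A \<longleftrightarrow> spectral_bound (spectrum A) M"
    by blast
  with spectral_bound_replacement[OF \<open>BC m\<close>] show ?thesis
    unfolding spectral_bound_def by blast
qed

end
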